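(* Assume $2\mu\bar c>\sigma^2 r$ and let $(v,u)$ be a pair as described in the context. Define the dividend ratcheting free boundary $$\mathcal{X}(c)=\inf\{x>0 : v_c(x,c)=0\},\quad c\in[0,\bar c].$$ Then $\mathcal{X}(c)>0$ for all $c\in[0,\bar c]$. Also: (1) for all $(x,c)\in\mathcal{Q}$, $v_c(x,c)=0$ if $x\ge\mathcal{X}(c)$, and $v_c(x,c)<0$ if $0<x<\mathcal{X}(c)$; (2) $\mathcal{X}(\cdot)\in C^\infty[0,\bar c]$; (3) there exist two constants $0<K_1<K_2$ such that $K_1\le\mathcal{X}'(c)\le K_2$ for all $c\in[0,\bar c]$. As a consequence, both $\mathcal{X}(\cdot)$ and its inverse $\mathcal{X}^{-1}(\cdot)$ are strictly increasing and Lipschitz continuous.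
   Context: Fix constants $\mu>0$, $\sigma>0$, $r>0$, $\bar c\in[0,\mu]$ with $2\mu\bar c>\sigma^2r$. Write $\mathbb{R}^+=[0,\infty)$, $\mathcal{Q}=\mathbb{R}^+\times[0,\bar c]$. Let $g(x)=\frac{\bar c}{r}(1-e^{-\gamma x})$ with $\gamma=\frac{(\mu-\bar c)+\sqrt{(\mu-\bar c)^2+2\sigma^2 r}}{\sigma^2}$, and for $c\in[0,\bar c]$ let $\mathcal{L}_c v=\tfrac12\sigma^2 v_{xx}+(\mu-c)v_x-rv$. $W^{2,p}_{\rm loc}(\mathbb{R}^+)$ denotes functions belonging to $W^{2,p}((0,L))$ for every $L>0$. $(v,u)$ is a pair of functions on $\mathcal{Q}$ (such a pair exists) with the following properties. (a) $v(x,c)=g(x)+\int_c^{\bar c}u(x,s)\,ds$ on $\mathcal{Q}$ (so $u=-v_c$). (b) $v:\mathcal{Q}\to\mathbb{R}$ solves the HJB equation $\min\{-\mathcal{L}_cv-c,-v_c\}=0$: $v,v_x,v_c$ are continuous and bounded in $\mathcal{Q}$, $v_c\le0$, $v(\cdot,c)\in W^{2,p}_{\rm loc}(\mathbb{R}^+)$ for each $c\in[0,\bar c]$, $p>1$; $v(0,c)=0$ and $v(x,\bar c)=g(x)$; for each $c$, $-\mathcal{L}_cv(\cdot,c)-c\ge0$ a.e. in $\mathbb{R}^+$; and if $v_c(x,c)<0$ then $-\mathcal{L}_cv(y,c)-c=0$ for all $y\in[0,x]$ (classically). (c) $u:\mathcal{Q}\to\mathbb{R}^+$ solves $\min\{-\mathcal{L}_cu-g'(x)-\int_c^{\bar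 c}u_x(x,s)ds+1,u\}=0$: $u,u_x$ are continuous and bounded in $\mathcal{Q}$, $u(\cdot,c)\in W^{2,p}_{\rm loc}(\mathbb{R}^+)$ for each $c\in[0,\bar c]$, $p>1$; $u(0,c)=0$; for each $c$, $-\mathcal{L}_cu-g'(x)-\int_c^{\bar c}u_x(x,s)ds+1\ge0$ a.e. in $\mathbb{R}^+$; and if $u(x,c)>0$ then $-\mathcal{L}_cu(y,c)-g'(y)-\int_c^{\bar c}u_x(y,s)ds+1=0$ for all $y\in[0,x]$. (d) For each $\alpha\in(0,1)$ there is $K>0$ such that for all $(x,c)\in\mathcal{Q}$: $0\le v\le\bar c/r$; $0\le v_x\le K$; $0\le -v_c\le K$; $v_x(y,c)\le\max\{v_x(x,c),1\}$ for all $y\ge x$; $|u(\cdot,c)|_{C^{1+\alpha}(\mathbb{R}^+)}\le K$; $|u_c(\cdot,c)|\le K$. *)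

theory Defs
  imports "HOL-Analysis.Analysis"
begin

subsection \<open>Smooth functions, weak derivatives, Sobolev and Hoelder spaces in one dimension\<close>

text \<open>
  Derivatives are taken within \<open>S\<close>, hence they are one-sided at the endpoints of an interval.
  \<open>D k\<close> is the \<open>k\<close>-th derivative of \<open>f\<close> on \<open>S\<close>; its continuity follows from its
  differentiability.
\<close>

definition C_infinity_on :: "real set \<Rightarrow> (real \<Rightarrow> real) \<Rightarrow> bool" where
  "C_infinity_on S f \<longleftrightarrow>
     (\<exists>D :: nat \<Rightarrow> real \<Rightarrow> real. (\<forall>x\<in>S. D 0 x = f x) \<and>
        (\<forall>k. \<forall>x\<in>S. (D k has_real_derivative D (Suc k) x) (at x within S)))"

definition test_function :: "real set \<Rightarrow> (real \<Rightarrow> real) \<Rightarrow> bool" where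
  "test_function S \<phi> \<longleftrightarrow>
     C_infinity_on UNIV \<phi> \<and> compact (closure {x. \<phi> x \<noteq> 0}) \<and> closure {x. \<phi> x \<noteq> 0} \<subseteq> S"

definition locally_integrable_on :: "real set \<Rightarrow> (real \<Rightarrow> real) \<Rightarrow> bool" where
  "locally_integrable_on S f \<longleftrightarrow> (\<forall>K. compact K \<and> K \<subseteq> S \<longrightarrow> integrable (lebesgue_on K) f)"

definition weak_derivative_on :: "real set \<Rightarrow> (real \<Rightarrow> real) \<Rightarrow> (real \<Rightarrow> real) \<Rightarrow> bool" where
  "weak_derivative_on S f h \<longleftrightarrow>
     locally_integrable_on S f \<and> locally_integrable_on S h \<and>
     (\<forall>\<phi>. test_function S \<phi> \<longrightarrow>
        (\<integral>x. f x * deriv \<phi> x \<partial>lebesgue_on S) = - (\<integral>x. h x * \<phi> x \<partial>lebesgue_on S))"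

definition weak_second_derivative_on :: "real set \<Rightarrow> (real \<Rightarrow> real) \<Rightarrow> (real \<Rightarrow> real) \<Rightarrow> bool" where
  "weak_second_derivative_on S f h \<longleftrightarrow>
     (\<exists>f'. weak_derivative_on S f f' \<and> weak_derivative_on S f' h)"

definition Lp_on :: "real \<Rightarrow> real set \<Rightarrow> (real \<Rightarrow> real) \<Rightarrow> bool" where
  "Lp_on p S f \<longleftrightarrow>
     f \<in> borel_measurable (lebesgue_on S) \<and> integrable (lebesgue_on S) (\<lambda>x. \<bar>f x\<bar> powr p)"

definition W2p_on :: "real \<Rightarrow> real set \<Rightarrow> (real \<Rightarrow> real) \<Rightarrow> bool" where
  "W2p_on p S f \<longleftrightarrow>
     (\<exists>f' f''. weak_derivative_on S f f' \<and> weak_derivative_on S f' f'' \<and>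
        Lp_on p S f \<and> Lp_on p S f' \<and> Lp_on p S f'')"

definition W2p_loc :: "real \<Rightarrow> (real \<Rightarrow> real) \<Rightarrow> bool" where
  "W2p_loc p f \<longleftrightarrow> (\<forall>L>0. W2p_on p {0<..<L} f)"

text \<open>
  The norm of \<open>C\<^sup>1\<^sup>+\<^sup>\<alpha>\<close> on the closed half line, with value infinity if one of the suprema is
  infinite. It is meant for functions that are differentiable within \<open>{0..}\<close>.
\<close>

definition C1alpha_norm :: "real \<Rightarrow> (real \<Rightarrow> real) \<Rightarrow> ereal" where
  "C1alpha_norm \<alpha> f =
     (let f' = (\<lambda>x. vector_derivative f (at x within {0..})) in
        (SUP x\<in>{0..}. ereal \<bar>f x\<bar>) + (SUP x\<in>{0..}. ereal \<bar>f' x\<bar>) +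
        (SUP (x, y)\<in>{(x, y). 0 \<le> x \<and> 0 \<le> y \<and> x \<noteq> y}.
           ereal (\<bar>f' x - f' y\<bar> / \<bar>x - y\<bar> powr \<alpha>)))"

subsection \<open>The ratcheting problem\<close>

text \<open>
  Functions on the state space are curried, and their values off it are irrelevant: the partial
  derivatives are taken within \<open>{0..}\<close> and \<open>{0..cb}\<close>. They are only meaningful
  where the derivative exists, which is required separately.
\<close>

definition state_space :: "real \<Rightarrow> (real \<times> real) set" where
  "state_space cb = {0..} \<times> {0..cb}"

definition partial_x :: "(real \<Rightarrow> real \<Rightarrow> real) \<Rightarrow> real \<Rightarrow> real \<Rightarrow> real" where
  "partial_x w x c = vector_derivative (\<lambda>y. w y c) (at x within {0..})"

definition partial_c :: "real \<Rightarrow> (real \<Rightarrow> real \<Rightarrow> real) \<Rightarrow> real \<Rightarrow> real \<Rightarrow> real" where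
  "partial_c cb w x c = vector_derivative (\<lambda>s. w x s) (at c within {0..cb})"

definition x_differentiable_at :: "(real \<Rightarrow> real \<Rightarrow> real) \<Rightarrow> real \<Rightarrow> real \<Rightarrow> bool" where
  "x_differentiable_at w x c \<longleftrightarrow> (\<lambda>y. w y c) differentiable (at x within {0..})"

definition c_differentiable_at :: "real \<Rightarrow> (real \<Rightarrow> real \<Rightarrow> real) \<Rightarrow> real \<Rightarrow> real \<Rightarrow> bool" where
  "c_differentiable_at cb w x c \<longleftrightarrow> (\<lambda>s. w x s) differentiable (at c within {0..cb})"

definition continuous_bounded :: "real \<Rightarrow> (real \<Rightarrow> real \<Rightarrow> real) \<Rightarrow> bool" where
  "continuous_bounded cb w \<longleftrightarrow>
     continuous_on (state_space cb) (\<lambda>(x, c). w x c) \<and>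
     bounded ((\<lambda>(x, c). w x c) ` state_space cb)"

definition gam :: "real \<Rightarrow> real \<Rightarrow> real \<Rightarrow> real \<Rightarrow> real" where
  "gam \<mu> \<sigma> r cb = ((\<mu> - cb) + sqrt ((\<mu> - cb)\<^sup>2 + 2 * \<sigma>\<^sup>2 * r)) / \<sigma>\<^sup>2"

definition gfun :: "real \<Rightarrow> real \<Rightarrow> real \<Rightarrow> real \<Rightarrow> real \<Rightarrow> real" where
  "gfun \<mu> \<sigma> r cb x = cb / r * (1 - exp (- gam \<mu> \<sigma> r cb * x))"

text \<open>
  The operator \<open>\<L>\<^sub>c\<close> applied to \<open>w(\<cdot>, c)\<close> at \<open>x\<close>. The second derivative is passed as the value
  \<open>wxx\<close> because it is classical in the equations and weak in the almost-everywhere inequalities.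
\<close>

definition Lop :: "real \<Rightarrow> real \<Rightarrow> real \<Rightarrow> real \<Rightarrow> (real \<Rightarrow> real \<Rightarrow> real) \<Rightarrow> real \<Rightarrow> real \<Rightarrow> real" where
  "Lop \<mu> \<sigma> r c w wxx x = 1/2 * \<sigma>\<^sup>2 * wxx + (\<mu> - c) * partial_x w x c - r * w x c"

definition HJB_solution :: "real \<Rightarrow> real \<Rightarrow> real \<Rightarrow> real \<Rightarrow> (real \<Rightarrow> real \<Rightarrow> real) \<Rightarrow> bool" where
  "HJB_solution \<mu> \<sigma> r cb v \<longleftrightarrow>
     (\<forall>x\<ge>0. \<forall>c\<in>{0..cb}. x_differentiable_at v x c \<and> c_differentiable_at cb v x c) \<and>
     continuous_bounded cb v \<and> continuous_bounded cb (partial_x v) \<and>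
     continuous_bounded cb (partial_c cb v) \<and>
     (\<forall>x\<ge>0. \<forall>c\<in>{0..cb}. partial_c cb v x c \<le> 0) \<and>
     (\<forall>c\<in>{0..cb}. \<forall>p>1. W2p_loc p (\<lambda>x. v x c)) \<and>
     (\<forall>c\<in>{0..cb}. v 0 c = 0) \<and>
     (\<forall>x\<ge>0. v x cb = gfun \<mu> \<sigma> r cb x) \<and>
     (\<forall>c\<in>{0..cb}. \<exists>vxx. weak_second_derivative_on {0<..} (\<lambda>x. v x c) vxx \<and>
        (AE x in lebesgue_on {0..}. - Lop \<mu> \<sigma> r c v (vxx x) x - c \<ge> 0)) \<and>
     (\<forall>x\<ge>0. \<forall>c\<in>{0..cb}. partial_c cb v x c < 0 \<longrightarrow>
        (\<forall>y\<in>{0..x}. x_differentiable_at (partial_x v) y c \<and>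
           - Lop \<mu> \<sigma> r c v (partial_x (partial_x v) y c) y - c = 0))"

definition obstacle_expr ::
  "real \<Rightarrow> real \<Rightarrow> real \<Rightarrow> real \<Rightarrow> (real \<Rightarrow> real \<Rightarrow> real) \<Rightarrow> real \<Rightarrow> real \<Rightarrow> real \<Rightarrow> real" where
  "obstacle_expr \<mu> \<sigma> r cb u uxx x c =
     - Lop \<mu> \<sigma> r c u uxx x - deriv (gfun \<mu> \<sigma> r cb) x
     - integral {c..cb} (\<lambda>s. partial_x u x s) + 1"

definition obstacle_solution :: "real \<Rightarrow> real \<Rightarrow> real \<Rightarrow> real \<Rightarrow> (real \<Rightarrow> real \<Rightarrow> real) \<Rightarrow> bool" where
  "obstacle_solution \<mu> \<sigma> r cb u \<longleftrightarrow>
     (\<forall>x\<ge>0. \<forall>c\<in>{0..cb}. 0 \<le> u x c \<and> x_differentiable_at u x c) \<and>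
     continuous_bounded cb u \<and> continuous_bounded cb (partial_x u) \<and>
     (\<forall>c\<in>{0..cb}. \<forall>p>1. W2p_loc p (\<lambda>x. u x c)) \<and>
     (\<forall>c\<in>{0..cb}. u 0 c = 0) \<and>
     (\<forall>c\<in>{0..cb}. \<exists>uxx. weak_second_derivative_on {0<..} (\<lambda>x. u x c) uxx \<and>
        (AE x in lebesgue_on {0..}. obstacle_expr \<mu> \<sigma> r cb u (uxx x) x c \<ge> 0)) \<and>
     (\<forall>x\<ge>0. \<forall>c\<in>{0..cb}. u x c > 0 \<longrightarrow>
        (\<forall>y\<in>{0..x}. x_differentiable_at (partial_x u) y c \<and>
           obstacle_expr \<mu> \<sigma> r cb u (partial_x (partial_x u) y c) y c = 0))"

definition estimates ::
  "real \<Rightarrow> real \<Rightarrow> (real \<Rightarrow> real \<Rightarrow> real) \<Rightarrow> (real \<Rightarrow> real \<Rightarrow> real) \<Rightarrow> bool" where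
  "estimates r cb v u \<longleftrightarrow>
     (\<forall>\<alpha>. 0 < \<alpha> \<and> \<alpha> < 1 \<longrightarrow>
        (\<exists>K>0. \<forall>x\<ge>0. \<forall>c\<in>{0..cb}.
           0 \<le> v x c \<and> v x c \<le> cb / r \<and>
           0 \<le> partial_x v x c \<and> partial_x v x c \<le> K \<and>
           0 \<le> - partial_c cb v x c \<and> - partial_c cb v x c \<le> K \<and>
           (\<forall>y\<ge>x. partial_x v y c \<le> max (partial_x v x c) 1) \<and>
           C1alpha_norm \<alpha> (\<lambda>z. u z c) \<le> ereal K \<and>
           c_differentiable_at cb u x c \<and> \<bar>partial_c cb u x c\<bar> \<le> K))"

definition solution_pair ::
  "real \<Rightarrow> real \<Rightarrow> real \<Rightarrow> real \<Rightarrow> (real \<Rightarrow> real \<Rightarrow> real) \<Rightarrow> (real \<Rightarrow> real \<Rightarrow> real) \<Rightarrow> bool" where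
  "solution_pair \<mu> \<sigma> r cb v u \<longleftrightarrow>
     (\<forall>x\<ge>0. \<forall>c\<in>{0..cb}. v x c = gfun \<mu> \<sigma> r cb x + integral {c..cb} (\<lambda>s. u x s)) \<and>
     HJB_solution \<mu> \<sigma> r cb v \<and> obstacle_solution \<mu> \<sigma> r cb u \<and> estimates r cb v u"

text \<open>
  The infimum is taken in the reals, where the infimum of the empty set is unspecified; a theorem
  about the free boundary has to assert or imply that the set is nonempty.
\<close>

definition free_boundary :: "real \<Rightarrow> (real \<Rightarrow> real \<Rightarrow> real) \<Rightarrow> real \<Rightarrow> real" where
  "free_boundary cb v c = Inf {x. x > 0 \<and> partial_c cb v x c = 0}"

end

theory Submission
  imports Defs "HOL-Real_Asymp.Real_Asymp"
begin

text \<open>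
  Put \<open>u = - v\<^sub>c\<close>. For fixed \<open>c\<close>, once \<open>u\<close> vanishes it can never become positive again (it would
  grow exponentially), and \<open>v\<^sub>x(0, c) > 1\<close> forces \<open>u > 0\<close> near \<open>0\<close>. Below the boundary \<open>X(c)\<close> both \<open>v\<close>
  and \<open>u\<close> are therefore explicit combinations of the exponentials with the characteristic exponents, with
  one unknown coefficient \<open>A(c)\<close> and its derivative. Let \<open>\<psi>\<close> be the solution of the adjoint
  equation with \<open>\<psi>(0) = 0\<close>. The smooth fit \<open>u = u\<^sub>x = 0\<close> at \<open>X(c)\<close> says that \<open>J(x, c)\<close>, the integral of
  \<open>\<psi> (1 - v\<^sub>x)\<close> over \<open>[0, x]\<close>, vanishes at \<open>x = X(c)\<close>. There \<open>J\<^sub>c < 0\<close>, since it is a negative multiple of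
  the integral of \<open>\<psi>' u\<close>, and this in turn excludes \<open>v\<^sub>x = 1\<close> at the boundary, so \<open>J\<^sub>x > 0\<close>. Hence
  \<open>X' = - J\<^sub>c / J\<^sub>x > 0\<close>, and as \<open>X'\<close> and \<open>A'\<close> are elementary expressions in \<open>c\<close>, \<open>X(c)\<close>, \<open>A(c)\<close> and the
  exponents, repeated differentiation gives smoothness.
\<close>

subsection \<open>Smoothness from an algebra closed under differentiation\<close>

text \<open>Two obstacles shape the argument. The boundary cannot be differentiated through
  \<open>u(X(c), c) = 0\<close>, because \<open>u_x\<close> vanishes there too and
  \<open>u_c\<close> would involve the second derivative of the unknown coefficient. The Wronskian
  of \<open>u\<close> with the homogeneous solution that vanishes at 0 avoids both: times an
  integrating factor it equals \<open>2 / \<sigma>\<^sup>2 * J\<close>, from which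
  \<open>A'(c)\<close> has dropped out. Thus \<open>J\<close> at fixed \<open>x\<close> is
  differentiable in \<open>c\<close> as soon as \<open>A\<close> is, and it crosses 0 with positive
  slope. The second obstacle is that nothing is known in advance about \<open>X\<close> as a
  function of \<open>c\<close>. The coefficient \<open>A(c)\<close> is therefore read off at one
  fixed point \<open>e0\<close> below all boundary points, where \<open>v_c = - u\<close> makes it
  differentiable; compactness of the interval of \<open>c\<close> supplies such a point. The
  derivative found this way still contains \<open>u(e0, c)\<close>. Evaluating the explicit form of
  \<open>u\<close> at \<open>X(c)\<close>, where \<open>u\<close> is 0, removes it, and only then do
  the derivatives of \<open>X\<close> and \<open>A\<close> form a closed system.\<close>

inductive_set smooth_algebra :: "real set \<Rightarrow> (real \<Rightarrow> real) set \<Rightarrow> (real \<Rightarrow> real) set"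
  for S B where
  base: "f \<in> B \<Longrightarrow> f \<in> smooth_algebra S B"
| const: "(\<lambda>x. a) \<in> smooth_algebra S B"
| add: "f \<in> smooth_algebra S B \<Longrightarrow> g \<in> smooth_algebra S B \<Longrightarrow> (\<lambda>x. f x + g x) \<in> smooth_algebra S B"
| mult: "f \<in> smooth_algebra S B \<Longrightarrow> g \<in> smooth_algebra S B \<Longrightarrow> (\<lambda>x. f x * g x) \<in> smooth_algebra S B"
| inverse: "f \<in> smooth_algebra S B \<Longrightarrow> (\<And>x. x \<in> S \<Longrightarrow> f x \<noteq> 0) \<Longrightarrow>
    (\<lambda>x. inverse (f x)) \<in> smooth_algebra S B"
| exp: "f \<in> smooth_algebra S B \<Longrightarrow> (\<lambda>x. exp (f x)) \<in> smooth_algebra S B"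

lemma smooth_algebra_uminus:
  assumes "f \<in> smooth_algebra S B" shows "(\<lambda>x. - f x) \<in> smooth_algebra S B"
  using smooth_algebra.mult[OF smooth_algebra.const[of "-1"] assms] by simp

lemma smooth_algebra_diff:
  assumes "f \<in> smooth_algebra S B" "g \<in> smooth_algebra S B"
  shows "(\<lambda>x. f x - g x) \<in> smooth_algebra S B"
  using smooth_algebra.add[OF assms(1) smooth_algebra_uminus[OF assms(2)]] by simp

lemma smooth_algebra_divide:
  assumes "f \<in> smooth_algebra S B" "g \<in> smooth_algebra S B" "\<And>x. x \<in> S \<Longrightarrow> g x \<noteq> 0"
  shows "(\<lambda>x. f x / g x) \<in> smooth_algebra S B"
  using smooth_algebra.mult[OF assms(1) smooth_algebra.inverse[OF assms(2,3)]]
  by (simp add: divide_inverse)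

text \<open>The sum, product, reciprocal and chain rules stay inside the algebra, so only the
  generators need an explicit derivative. Iterating then gives derivatives of all orders.\<close>

lemma smooth_algebra_derivative:
  assumes B: "\<And>f. f \<in> B \<Longrightarrow>
      \<exists>g\<in>smooth_algebra S B. \<forall>x\<in>S. (f has_real_derivative g x) (at x within S)"
    and "f \<in> smooth_algebra S B"
  shows "\<exists>g\<in>smooth_algebra S B. \<forall>x\<in>S. (f has_real_derivative g x) (at x within S)"
  using assms(2)
proof (induction rule: smooth_algebra.induct)
  case (base f) then show ?case by (rule B)
next
  case (const a) show ?case
    by (rule bexI[OF _ smooth_algebra.const[of 0]]) auto
next
  case (add f g)
  obtain f' where f': "f' \<in> smooth_algebra S B"
    "\<forall>x\<in>S. (f has_real_derivative f' x) (at x within S)" using add.IH(1) by (rule bexE)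
  obtain g' where g': "g' \<in> smooth_algebra S B"
    "\<forall>x\<in>S. (g has_real_derivative g' x) (at x within S)" using add.IH(2) by (rule bexE)
  from f' g' show ?case
    by (intro bexI[where x="\<lambda>x. f' x + g' x"] smooth_algebra.add ballI)
      (auto intro!: derivative_eq_intros)
next
  case (mult f g)
  obtain f' where f': "f' \<in> smooth_algebra S B"
    "\<forall>x\<in>S. (f has_real_derivative f' x) (at x within S)" using mult.IH(1) by (rule bexE)
  obtain g' where g': "g' \<in> smooth_algebra S B"
    "\<forall>x\<in>S. (g has_real_derivative g' x) (at x within S)" using mult.IH(2) by (rule bexE)
  from f' g' show ?case using mult.hyps
    by (intro bexI[where x="\<lambda>x. f' x * g x + g' x * f x"] smooth_algebra.add smooth_algebra.mult ballI)
      (auto intro!: DERIV_mult)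
next
  case (inverse f)
  obtain f' where f': "f' \<in> smooth_algebra S B"
    "\<forall>x\<in>S. (f has_real_derivative f' x) (at x within S)" using inverse.IH by (rule bexE)
  have "(\<lambda>x. - (f' x * (inverse (f x) * inverse (f x)))) \<in> smooth_algebra S B"
    by (intro smooth_algebra_uminus smooth_algebra.mult smooth_algebra.inverse f'(1) inverse.hyps)
  moreover have "((\<lambda>x. inverse (f x)) has_real_derivative - (f' x * (inverse (f x) * inverse (f x))))
      (at x within S)" if "x \<in> S" for x
    using DERIV_inverse_fun[of f "f' x" x S] f' inverse that by (simp add: power2_eq_square)
  ultimately show ?case by (intro bexI ballI)
next
  case (exp f)
  obtain f' where f': "f' \<in> smooth_algebra S B"
    "\<forall>x\<in>S. (f has_real_derivative f' x) (at x within S)" using exp.IH by (rule bexE)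
  then show ?case using exp.hyps
    by (intro bexI[where x="\<lambda>x. exp (f x) * f' x"] smooth_algebra.mult smooth_algebra.exp ballI)
      (auto intro!: derivative_eq_intros)
qed

lemma smooth_algebra_C_infinity_on:
  assumes B: "\<And>f. f \<in> B \<Longrightarrow>
      \<exists>g\<in>smooth_algebra S B. \<forall>x\<in>S. (f has_real_derivative g x) (at x within S)"
    and f: "f \<in> smooth_algebra S B"
  shows "C_infinity_on S f"
proof -
  obtain d where d: "\<And>f. f \<in> smooth_algebra S B \<Longrightarrow> d f \<in> smooth_algebra S B \<and>
      (\<forall>x\<in>S. (f has_real_derivative d f x) (at x within S))"
    using smooth_algebra_derivative[OF B] by metis
  have "(d ^^ k) f \<in> smooth_algebra S B" for k
    by (induction k) (use f d in auto)
  with d show ?thesis unfolding C_infinity_on_def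
    by (intro exI[where x="\<lambda>k. (d ^^ k) f"]) auto
qed

subsection \<open>Bump functions\<close>

text \<open>For \<open>k = 0\<close> the classical flat function; the factor
  \<open>inverse x ^ k\<close> makes the family closed under differentiation up to linear
  combinations.\<close>

definition flat :: "nat \<Rightarrow> real \<Rightarrow> real" where
  "flat k x = (if 0 < x then exp (- inverse x) * inverse x ^ k else 0)"

lemma flat_derivative:
  "(flat k has_real_derivative flat (k + 2) x - real k * flat (k + 1) x) (at x)"
proof -
  consider "x < 0" | "x = 0" | "x > 0" by linarith
  then show ?thesis
  proof cases
    case 1
    have "((\<lambda>_. 0) has_real_derivative flat (k + 2) x - real k * flat (k + 1) x) (at x)"
      using 1 by (auto simp: flat_def)
    then show ?thesis
      by (rule has_field_derivative_transform_within_open[where S="{..<0}"])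
        (use 1 in \<open>auto simp: flat_def\<close>)
  next
    case 3
    have "((\<lambda>x. exp (- inverse x) * inverse x ^ k) has_real_derivative
        flat (k + 2) x - real k * flat (k + 1) x) (at x)"
      using 3 power_eq_if[of x "k - 1"] by (cases k)
        (auto intro!: derivative_eq_intros simp: flat_def field_simps power2_eq_square split: if_splits)
    then show ?thesis
      by (rule has_field_derivative_transform_within_open[where S="{0<..}"])
        (use 3 in \<open>auto simp: flat_def\<close>)
  next
    case 2
    \<comment> \<open>With \<open>y = inverse x\<close> the difference quotient at 0 from the right
      becomes \<open>y ^ (k + 1) / exp y\<close>.\<close>
    have "((\<lambda>y::real. y ^ (k + 1) / exp y) \<longlongrightarrow> 0) at_top"
      by (rule tendsto_power_div_exp_0)
    then have "((\<lambda>x. inverse x ^ (k + 1) / exp (inverse x)) \<longlongrightarrow> (0::real)) (at_right 0)"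
      by (rule filterlim_compose[OF _ filterlim_inverse_at_top_right])
    then have "((\<lambda>y. (flat k y - flat k 0) / (y - 0)) \<longlongrightarrow> 0) (at_right 0)"
    proof (rule Lim_transform_eventually)
      have "inverse y ^ (k + 1) / exp (inverse y) = (flat k y - flat k 0) / (y - 0)" if "y > 0" for y
        using that by (simp add: flat_def exp_minus field_simps)
      then show "\<forall>\<^sub>F y in at_right 0. inverse y ^ (k + 1) / exp (inverse y) = (flat k y - flat k 0) / (y - 0)"
        by (intro eventually_mono[OF eventually_at_right_less[of 0]])
    qed
    moreover have "((\<lambda>y. (flat k y - flat k 0) / (y - 0)) \<longlongrightarrow> 0) (at_left 0)"
      by (rule Lim_transform_eventually[OF tendsto_const])
        (auto simp: flat_def eventually_at_left_field intro!: exI[of _ "-1"])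
    ultimately have "(flat k has_real_derivative 0) (at 0)"
      unfolding has_field_derivative_iff filterlim_at_split by simp
    then show ?thesis using 2 by (simp add: flat_def)
  qed
qed

text \<open>A weak second derivative is a weak derivative taken twice, so integrating by parts twice
  tests with \<open>deriv \<phi>\<close> first.\<close>

lemma test_function_deriv:
  assumes "test_function S \<phi>" shows "test_function S (deriv \<phi>)"
proof -
  obtain D where D0: "\<And>x. D 0 x = \<phi> x"
    and D: "\<And>k x. (D k has_real_derivative D (Suc k) x) (at x)"
    using assms unfolding test_function_def C_infinity_on_def by auto
  have "\<phi> = D 0" using D0 by auto
  then have d: "deriv \<phi> = D (Suc 0)" using D[of 0] by (auto intro!: DERIV_imp_deriv)
  have "C_infinity_on UNIV (deriv \<phi>)"
    unfolding C_infinity_on_def d by (rule exI[where x="\<lambda>k. D (Suc k)"]) (use D in auto)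
  moreover have "closure {x. deriv \<phi> x \<noteq> 0} \<subseteq> closure {x. \<phi> x \<noteq> 0}"
  proof (rule closure_minimal)
    show "{x. deriv \<phi> x \<noteq> 0} \<subseteq> closure {x. \<phi> x \<noteq> 0}"
    proof (rule subsetI, rule ccontr)
      fix x assume x: "x \<in> {x. deriv \<phi> x \<noteq> 0}" "x \<notin> closure {x. \<phi> x \<noteq> 0}"
      have "((\<lambda>_. 0) has_real_derivative 0) (at x)" by simp
      then have "(\<phi> has_real_derivative 0) (at x)"
        by (rule has_field_derivative_transform_within_open[where S="- closure {x. \<phi> x \<noteq> 0}"])
          (use x closure_subset[of "{x. \<phi> x \<noteq> 0}"] in auto)
      then show False using x(1) by (simp add: DERIV_imp_deriv)
    qed
  qed simp
  ultimately show ?thesis using assms unfolding test_function_def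
    by (meson closed_closure compact_Int_closed compact_eq_bounded_closed bounded_subset order_trans)
qed

lemma bump_function_exists:
  fixes a b :: real
  assumes "a < b"
  obtains \<phi> where "C_infinity_on UNIV \<phi>" "\<And>x. 0 \<le> \<phi> x" "\<And>x. 0 < \<phi> x \<longleftrightarrow> a < x \<and> x < b"
proof
  let ?B = "range (\<lambda>k x. flat k (x - a)) \<union> range (\<lambda>k x. flat k (b - x))"
  let ?\<phi> = "\<lambda>x. flat 0 (x - a) * flat 0 (b - x)"
  have "\<exists>g\<in>smooth_algebra UNIV ?B. \<forall>x\<in>UNIV. (f has_real_derivative g x) (at x)" if f: "f \<in> ?B" for f
    using f
  proof
    assume "f \<in> range (\<lambda>k x. flat k (x - a))"
    then obtain k where f: "f = (\<lambda>x. flat k (x - a))" by auto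
    have "(\<lambda>x. flat (k + 2) (x - a) - real k * flat (k + 1) (x - a)) \<in> smooth_algebra UNIV ?B"
      by (intro smooth_algebra_diff smooth_algebra.mult smooth_algebra.const smooth_algebra.base) auto
    moreover have "(f has_real_derivative (flat (k + 2) (x - a) - real k * flat (k + 1) (x - a)) * 1) (at x)" for x
      unfolding f by (rule DERIV_chain2[OF flat_derivative]) (auto intro!: derivative_eq_intros)
    ultimately show ?thesis by (intro bexI ballI) auto
  next
    assume "f \<in> range (\<lambda>k x. flat k (b - x))"
    then obtain k where f: "f = (\<lambda>x. flat k (b - x))" by auto
    have "(\<lambda>x. - (flat (k + 2) (b - x) - real k * flat (k + 1) (b - x))) \<in> smooth_algebra UNIV ?B"
      by (intro smooth_algebra_uminus smooth_algebra_diff smooth_algebra.mult smooth_algebra.const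
          smooth_algebra.base) auto
    moreover have "(f has_real_derivative (flat (k + 2) (b - x) - real k * flat (k + 1) (b - x)) * (- 1)) (at x)" for x
      unfolding f by (rule DERIV_chain2[OF flat_derivative]) (auto intro!: derivative_eq_intros)
    ultimately show ?thesis by (intro bexI ballI) auto
  qed
  moreover have "?\<phi> \<in> smooth_algebra UNIV ?B"
    by (intro smooth_algebra.mult smooth_algebra.base) auto
  ultimately show "C_infinity_on UNIV ?\<phi>"
    by (rule smooth_algebra_C_infinity_on)
qed (auto simp: flat_def zero_less_mult_iff)

text \<open>For a bump \<open>\<phi>\<close> on \<open>(a, b)\<close>, two integrations by parts
  equate the integral of \<open>f * \<phi>''\<close> with that of \<open>h * \<phi>\<close>. The
  former is 0, whereas the latter would be negative.\<close>

lemma weak_second_derivative_not_negative: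
  fixes a b :: real
  assumes w: "weak_second_derivative_on {0<..} f h" and ab: "0 < a" "a < b"
    and f0: "\<And>x. x \<in> {a..b} \<Longrightarrow> f x = 0"
    and neg: "AE x in lebesgue_on {0..}. a < x \<and> x < b \<longrightarrow> h x < 0"
  shows False
proof -
  obtain \<phi> where C: "C_infinity_on UNIV \<phi>" and nn: "\<And>x. 0 \<le> \<phi> x"
    and pos: "\<And>x. 0 < \<phi> x \<longleftrightarrow> a < x \<and> x < b"
    using bump_function_exists[OF ab(2)] by metis
  have supp: "{x. \<phi> x \<noteq> 0} = {a<..<b}"
    using nn pos by (auto simp: less_le)
  have T: "test_function {0<..} \<phi>"
    unfolding test_function_def supp using C ab by auto
  have clos: "\<phi> x = 0" if "x \<notin> {a..b}" for x
    using nn[of x] pos[of x] that by fastforce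
  have d2: "deriv (deriv \<phi>) x = 0" if "x \<notin> {a..b}" for x
  proof -
    have op: "open (- {a..b})" by auto
    have "((\<lambda>_. 0) has_real_derivative 0) (at y)" for y :: real by simp
    then have d1: "deriv \<phi> y = 0" if "y \<notin> {a..b}" for y
      using has_field_derivative_transform_within_open[OF _ op, of "\<lambda>_. 0" 0 y \<phi>] that clos
      by (simp add: DERIV_imp_deriv)
    have "((\<lambda>_. 0) has_real_derivative 0) (at x)" by simp
    then show ?thesis
      using has_field_derivative_transform_within_open[OF _ op, of "\<lambda>_. 0" 0 x "deriv \<phi>"] that d1
      by (simp add: DERIV_imp_deriv)
  qed
  obtain f' where f': "weak_derivative_on {0<..} f f'" "weak_derivative_on {0<..} f' h"
    using w unfolding weak_second_derivative_on_def by blast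
  have "(\<integral>x. f x * deriv (deriv \<phi>) x \<partial>lebesgue_on {0<..}) = - (\<integral>x. f' x * deriv \<phi> x \<partial>lebesgue_on {0<..})"
    using f'(1) test_function_deriv[OF T] unfolding weak_derivative_on_def by blast
  moreover have "(\<integral>x. f' x * deriv \<phi> x \<partial>lebesgue_on {0<..}) = - (\<integral>x. h x * \<phi> x \<partial>lebesgue_on {0<..})"
    using f'(2) T unfolding weak_derivative_on_def by blast
  moreover have "(\<lambda>x. f x * deriv (deriv \<phi>) x) = (\<lambda>x. 0)"
    using f0 d2 by fastforce
  ultimately have I0: "(\<integral>x. h x * \<phi> x \<partial>lebesgue_on {0<..}) = 0" by simp
  have cont: "continuous_on UNIV \<phi>"
  proof -
    obtain D where "\<And>x. D 0 x = \<phi> x" "\<And>k x. (D k has_real_derivative D (Suc k) x) (at x)"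
      using C unfolding C_infinity_on_def by auto
    then have "\<And>x. (\<phi> has_real_derivative D (Suc 0) x) (at x)" by (metis ext)
    then show ?thesis by (meson DERIV_continuous_on has_field_derivative_at_within)
  qed
  \<comment> \<open>\<open>h\<close> is only locally integrable. Confining \<open>h * \<phi>\<close>
    to \<open>[a, b]\<close> makes it integrable, so that the vanishing integral carries information
    and is not the default value.\<close>
  have "{a..b} \<subseteq> {0<..}" using ab by auto
  then have "integrable (lebesgue_on {a..b}) h"
    using f'(2) compact_Icc[of a b] unfolding weak_derivative_on_def locally_integrable_on_def by blast
  then have hK: "integrable lebesgue (\<lambda>x. indicator {a..b} x *\<^sub>R h x)"
    by (subst (asm) integrable_restrict_space) auto
  obtain M where M: "\<And>x. x \<in> {a..b} \<Longrightarrow> \<bar>\<phi> x\<bar> \<le> M"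
    using compact_imp_bounded[OF compact_continuous_image[OF continuous_on_subset[OF cont] compact_Icc[of a b]]]
    unfolding bounded_iff real_norm_def by blast
  have "integrable lebesgue (\<lambda>x. \<phi> x * (indicator {a..b} x *\<^sub>R h x))"
  proof (rule Bochner_Integration.integrable_bound)
    show "integrable lebesgue (\<lambda>x. M * (indicator {a..b} x *\<^sub>R h x))"
      using hK by simp
    have "\<phi> \<in> borel_measurable lebesgue"
      using cont by (simp add: borel_measurable_continuous_onI measurable_completion)
    then show "(\<lambda>x. \<phi> x * (indicator {a..b} x *\<^sub>R h x)) \<in> borel_measurable lebesgue"
      using hK by (auto intro!: borel_measurable_times dest: borel_measurable_integrable)
    show "AE x in lebesgue. norm (\<phi> x * (indicator {a..b} x *\<^sub>R h x)) \<le> norm (M * (indicator {a..b} x *\<^sub>R h x))"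
    proof (rule AE_I2)
      fix x
      show "norm (\<phi> x * (indicator {a..b} x *\<^sub>R h x)) \<le> norm (M * (indicator {a..b} x *\<^sub>R h x))"
        using M[of x] by (auto simp: indicator_def abs_mult intro!: mult_right_mono)
    qed
  qed
  moreover have "(\<lambda>x. \<phi> x * (indicator {a..b} x *\<^sub>R h x)) = (\<lambda>x. indicator {0<..} x *\<^sub>R (h x * \<phi> x))"
    using ab clos by (auto simp: fun_eq_iff indicator_def)
  ultimately have int: "integrable lebesgue (\<lambda>x. indicator {0<..} x *\<^sub>R (h x * \<phi> x))" by simp
  then have I1: "integral\<^sup>L lebesgue (\<lambda>x. - (indicator {0<..} x *\<^sub>R (h x * \<phi> x))) = 0"
    using I0 by (subst (asm) integral_restrict_space) auto
  have neg': "AE x in lebesgue. a < x \<and> x < b \<longrightarrow> h x < 0"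
    using neg by (subst (asm) AE_restrict_space_iff) (use ab in auto)
  have "AE x in lebesgue. - (indicator {0<..} x *\<^sub>R (h x * \<phi> x)) \<ge> 0"
    using neg'
  proof eventually_elim
    case (elim x)
    show ?case
      using elim nn[of x] supp by (cases "a < x \<and> x < b") (auto simp: mult_le_0_iff)
  qed
  then have "AE x in lebesgue. - (indicator {0<..} x *\<^sub>R (h x * \<phi> x)) = 0"
    using integral_nonneg_eq_0_iff_AE[of lebesgue "\<lambda>x. - (indicator {0<..} x *\<^sub>R (h x * \<phi> x))"] int I1
    by simp
  with neg' have "AE x in lebesgue. x \<notin> {a<..<b}"
  proof eventually_elim
    case (elim x)
    then show ?case using pos[of x] ab by auto
  qed
  then have "{a<..<b} \<in> null_sets lebesgue"
    by (subst (asm) AE_iff_null_sets[symmetric]) auto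
  then show False using ab by (simp add: null_sets_def)
qed

subsection \<open>Real calculus\<close>

lemma derivative_nonneg_at_zero:
  fixes f :: "real \<Rightarrow> real"
  assumes "(f has_real_derivative d) (at 0 within {0..})" "f 0 = 0" "\<And>x. 0 \<le> x \<Longrightarrow> 0 \<le> f x"
  shows "0 \<le> d"
proof -
  have "((\<lambda>y. (f y - f 0) / (y - 0)) \<longlongrightarrow> d) (at_right 0)"
    using assms(1) has_field_derivative_subset[of f d 0 "{0..}" "{0<..}"]
    unfolding has_field_derivative_iff by (auto simp: subset_iff)
  moreover have "\<forall>\<^sub>F y in at_right 0. 0 \<le> (f y - f 0) / (y - 0)"
    using eventually_at_right_less[of "0::real"] by eventually_elim (use assms in auto)
  ultimately show ?thesis
    by (rule tendsto_lowerbound) simp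
qed

lemma zero_of_nonneg_derivatives:
  fixes f f' :: "real \<Rightarrow> real"
  assumes f: "\<And>x. x > 0 \<Longrightarrow> (f has_real_derivative f' x) (at x)"
    and nn: "\<And>x. x > 0 \<Longrightarrow> 0 \<le> f x" and z: "0 < z" "f z = 0"
  shows "f' z = 0" and "(f' has_real_derivative f'') (at z) \<Longrightarrow> 0 \<le> f''"
proof -
  show 1: "f' z = 0"
    by (rule DERIV_local_min[OF f[OF z(1)] z(1)]) (use nn z in auto)
  assume f'': "(f' has_real_derivative f'') (at z)"
  show "0 \<le> f''"
  proof (rule ccontr)
    assume "\<not> 0 \<le> f''"
    then obtain d where d: "d > 0" "\<And>h. 0 < h \<Longrightarrow> h < d \<Longrightarrow> f' (z + h) < f' z"
      using DERIV_neg_dec_right[OF f''] by auto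
    have "\<exists>y>z. y < z + d / 2 \<and> f (z + d / 2) - f z = (z + d / 2 - z) * f' y"
      by (rule MVT2) (use d z f in auto)
    then obtain y where y: "z < y" "y < z + d / 2" "f (z + d / 2) = d / 2 * f' y"
      using z by auto
    have "f' y < 0" using d(2)[of "y - z"] y d(1) 1 by auto
    then have "d / 2 * f' y < 0" using d(1) by (simp add: mult_pos_neg)
    then have "f (z + d / 2) < 0" using y(3) by simp
    then show False using nn[of "z + d / 2"] z d by auto
  qed
qed

lemma first_zero:
  fixes f :: "real \<Rightarrow> real"
  assumes c: "continuous_on {a..b} f" and ab: "a \<le> b" "f b = 0"
    and nn: "\<And>x. x \<in> {a..b} \<Longrightarrow> 0 \<le> f x"
  obtains z where "z \<in> {a..b}" "f z = 0" "\<And>x. a \<le> x \<Longrightarrow> x < z \<Longrightarrow> 0 < f x"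
proof -
  let ?Z = "{x \<in> {a..b}. f x = 0}"
  have Z: "?Z = {a..b} \<inter> f -` {0}" by auto
  have "closed ({a..b} \<inter> f -` {0})"
    using continuous_closed_preimage[OF c, of "{0}"] by simp
  then have "compact ({a..b} \<inter> ({a..b} \<inter> f -` {0}))"
    by (intro compact_Int_closed) auto
  then have "compact ?Z" unfolding Z by simp
  moreover have "?Z \<noteq> {}" using ab by auto
  ultimately obtain z where z: "z \<in> ?Z" "\<And>y. y \<in> ?Z \<Longrightarrow> z \<le> y"
    using compact_attains_inf[of ?Z] by auto
  show thesis
  proof
    show "0 < f x" if "a \<le> x" "x < z" for x
      using z(1) z(2)[of x] nn[of x] that by (cases "f x = 0") (auto simp: less_le)
  qed (use z in auto)
qed

subsection \<open>The characteristic exponents and explicit solutions\<close>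

locale characteristic =
  fixes \<mu> \<sigma> r :: real
  assumes \<sigma>_pos: "\<sigma> > 0" and r_pos: "r > 0"
begin

text \<open>The roots of \<open>1/2 * \<sigma>\<^sup>2 * k\<^sup>2 + (\<mu> - c) * k - r\<close> are
  \<open>th c\<close> and \<open>- la c\<close>; \<open>la_minus_th\<close> and
  \<open>th_times_la\<close> are the relations of Vieta.\<close>

definition disc :: "real \<Rightarrow> real" where "disc c = sqrt ((\<mu> - c)\<^sup>2 + 2 * \<sigma>\<^sup>2 * r)"
definition th :: "real \<Rightarrow> real" where "th c = (disc c - (\<mu> - c)) / \<sigma>\<^sup>2"
definition la :: "real \<Rightarrow> real" where "la c = (disc c + (\<mu> - c)) / \<sigma>\<^sup>2"
text \<open>The logarithmic \<open>c\<close>-derivative of \<open>th\<close>, and minus that of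
  \<open>la\<close>.\<close>

definition kap :: "real \<Rightarrow> real" where "kap c = 1 / disc c"

lemma disc_gt: "\<bar>\<mu> - c\<bar> < disc c"
  unfolding disc_def using \<sigma>_pos r_pos by (intro real_less_rsqrt) simp

lemma disc_sq: "disc c * disc c = (\<mu> - c)\<^sup>2 + 2 * \<sigma>\<^sup>2 * r"
  using \<sigma>_pos r_pos unfolding disc_def by simp

lemma disc_pos: "0 < disc c" using disc_gt[of c] by linarith

lemma th_pos: "0 < th c" and la_pos: "0 < la c" and kap_pos: "0 < kap c"
  using disc_gt[of c] disc_pos[of c] \<sigma>_pos by (auto simp: th_def la_def kap_def)

lemma la_minus_th: "la c - th c = 2 / \<sigma>\<^sup>2 * (\<mu> - c)"
  using \<sigma>_pos by (simp add: th_def la_def field_simps)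

lemma th_times_la: "th c * la c = 2 / \<sigma>\<^sup>2 * r"
proof -
  have "(disc c - (\<mu> - c)) * (disc c + (\<mu> - c)) = 2 * \<sigma>\<^sup>2 * r"
    using disc_sq[of c] by (simp add: algebra_simps power2_eq_square)
  then show ?thesis using \<sigma>_pos by (simp add: th_def la_def field_simps power2_eq_square)
qed

lemma kap_eq: "kap c * (th c + la c) = 2 / \<sigma>\<^sup>2"
  using disc_pos[of c] \<sigma>_pos by (simp add: th_def la_def kap_def field_simps)

lemma kap_eq': "kap c = 2 / (\<sigma>\<^sup>2 * (th c + la c))"
  using kap_eq[of c] th_pos[of c] la_pos[of c] \<sigma>_pos
  by (simp add: eq_divide_eq mult.assoc[symmetric] mult.commute[of "\<sigma>\<^sup>2"])

lemma disc_derivative: "(disc has_real_derivative - ((\<mu> - c) / disc c)) (at c within S)"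
proof -
  have "0 < (\<mu> - c)\<^sup>2 + 2 * \<sigma>\<^sup>2 * r" using \<sigma>_pos r_pos by (simp add: add_nonneg_pos)
  then show ?thesis unfolding disc_def
    by (auto intro!: derivative_eq_intros simp: field_simps)
qed

lemma th_derivative: "(th has_real_derivative kap c * th c) (at c within S)"
  unfolding th_def kap_def using \<sigma>_pos disc_pos[of c]
  by (auto intro!: derivative_eq_intros disc_derivative simp: field_simps)

lemma la_derivative: "(la has_real_derivative - (kap c * la c)) (at c within S)"
  unfolding la_def kap_def using \<sigma>_pos disc_pos[of c]
  by (auto intro!: derivative_eq_intros disc_derivative simp: field_simps)

lemma continuous_on_th [continuous_intros]: "continuous_on S th"
  and continuous_on_la [continuous_intros]: "continuous_on S la"
proof -
  show "continuous_on S th" by (rule DERIV_continuous_on[OF th_derivative])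
  show "continuous_on S la" by (rule DERIV_continuous_on[OF la_derivative])
qed

text \<open>\<open>hom\<close> spans the solutions of the homogeneous equation that vanish at 0,
  \<open>psi\<close> those of its adjoint, whose exponents have the opposite signs.
  \<open>psi\<close> is \<open>hom\<close> times \<open>exp ((la c - th c) * x)\<close>, and
  \<open>chi\<close> is the derivative of \<open>hom\<close> times the same factor.\<close>

definition hom :: "real \<Rightarrow> real \<Rightarrow> real" where
  "hom c x = exp (th c * x) - 1 / exp (la c * x)"
definition psi :: "real \<Rightarrow> real \<Rightarrow> real" where
  "psi c x = exp (la c * x) - 1 / exp (th c * x)"
definition chi :: "real \<Rightarrow> real \<Rightarrow> real" where
  "chi c x = th c * exp (la c * x) + la c / exp (th c * x)"

lemma hom_pos: "0 < x \<Longrightarrow> 0 < hom c x" and hom_0 [simp]: "hom c 0 = 0"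
proof -
  assume "0 < x"
  then have "1 < exp (th c * x)" "1 < exp (la c * x)" using th_pos la_pos by auto
  then show "0 < hom c x" unfolding hom_def by (smt (verit) divide_less_eq_1)
qed (simp add: hom_def)

lemma psi_pos: "0 < x \<Longrightarrow> 0 < psi c x" and psi_0 [simp]: "psi c 0 = 0"
proof -
  assume "0 < x"
  then have "1 < exp (th c * x)" "1 < exp (la c * x)" using th_pos la_pos by auto
  then show "0 < psi c x" unfolding psi_def by (smt (verit) divide_less_eq_1)
qed (simp add: psi_def)

text \<open>Multiplied by the integrating factor \<open>psi / hom\<close>, the Wronskian of \<open>h\<close> and \<open>hom c\<close> is
  \<open>psi * h' - chi * h\<close>.\<close>

lemma wronskian_derivative:
  assumes "(h has_real_derivative h1 x) (at x within S)" "(h1 has_real_derivative h2) (at x within S)"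
  shows "((\<lambda>x. psi c x * h1 x - chi c x * h x) has_real_derivative
    psi c x * (h2 + (la c - th c) * h1 x - th c * la c * h x)) (at x within S)"
  unfolding psi_def chi_def
  by (rule derivative_eq_intros assms refl | simp add: field_simps)+

lemma quotient_hom_derivative:
  assumes "(h has_real_derivative h1 x) (at x within S)" "0 < x"
  shows "((\<lambda>x. h x / hom c x) has_real_derivative
    (psi c x * h1 x - chi c x * h x) * (exp (th c * x) / exp (la c * x)) / (hom c x)\<^sup>2) (at x within S)"
proof -
  have "(hom c has_real_derivative th c * exp (th c * x) + la c / exp (la c * x)) (at x within S)"
    unfolding hom_def by (rule derivative_eq_intros refl | simp)+
  then have "((\<lambda>x. h x / hom c x) has_real_derivative
      (h1 x * hom c x - h x * (th c * exp (th c * x) + la c / exp (la c * x))) / (hom c x * hom c x)) (at x within S)"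
    using hom_pos[OF assms(2), of c] by (intro DERIV_divide[OF assms(1)]) auto
  moreover have "h1 x * hom c x - h x * (th c * exp (th c * x) + la c / exp (la c * x))
      = (psi c x * h1 x - chi c x * h x) * (exp (th c * x) / exp (la c * x))"
    by (simp add: hom_def psi_def chi_def field_simps)
  ultimately show ?thesis by (simp add: power2_eq_square)
qed

text \<open>The weighted Wronskian of \<open>h\<close> and \<open>hom\<close> is constant and
  vanishes at 0, so \<open>h / hom\<close> is constant on \<open>(0, b)\<close>; its value at
  \<open>e\<close> is 0.\<close>

lemma homogeneous_solution_zero:
  assumes h: "\<And>x. 0 \<le> x \<Longrightarrow> x < b \<Longrightarrow> (h has_real_derivative h1 x) (at x within {0..})"
    and h1: "\<And>x. 0 \<le> x \<Longrightarrow> x < b \<Longrightarrow> (h1 has_real_derivative h2 x) (at x within {0..})"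
    and ode: "\<And>x. 0 \<le> x \<Longrightarrow> x < b \<Longrightarrow> h2 x + (la c - th c) * h1 x - th c * la c * h x = 0"
    and e: "0 < e" "e < b" "h 0 = 0" "h e = 0" and x: "0 \<le> x" "x < b"
  shows "h x = 0"
proof -
  let ?K = "\<lambda>x. psi c x * h1 x - chi c x * h x"
  have "(?K has_real_derivative 0) (at x within {0..<b})" if "x \<in> {0..<b}" for x
    by (rule has_field_derivative_subset[where s="{0..}"], rule DERIV_cong[OF wronskian_derivative[OF h h1]])
      (use that ode in auto)
  then obtain k where "\<forall>x\<in>{0..<b}. ?K x = k"
    using has_field_derivative_zero_constant[of "{0..<b}" ?K] by auto
  then have K: "?K x = 0" if "x \<in> {0..<b}" for x
    using that e by force
  have "((\<lambda>x. h x / hom c x) has_real_derivative 0) (at x within {0<..<b})" if "x \<in> {0<..<b}" for x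
    by (rule has_field_derivative_subset[where s="{0..}"], rule DERIV_cong[OF quotient_hom_derivative[OF h]])
      (use that K in auto)
  then obtain k where k: "\<forall>x\<in>{0<..<b}. h x / hom c x = k"
    using has_field_derivative_zero_constant[of "{0<..<b}" "\<lambda>x. h x / hom c x"] by auto
  with e have "k = 0" by force
  with k x e hom_pos[of x c] show ?thesis by (cases "x = 0") auto
qed

text \<open>
  \<open>Vf a c\<close> is the general solution of \<open>\<L>\<^sub>c V = - c\<close> with \<open>V(0) = 0\<close>, and \<open>Vx\<close>, \<open>Vxx\<close> are its
  derivatives. \<open>Uf a b c\<close> is minus its \<open>c\<close>-derivative when \<open>a\<close> depends on \<open>c\<close> with derivative \<open>b\<close>.
  \<open>Jf a c x\<close> is the integral of \<open>psi c * (1 - Vx a c)\<close> over \<open>[0, x]\<close>, and \<open>Jc a b c x\<close> its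
  \<open>c\<close>-derivative in the same sense.
\<close>

definition Vf :: "real \<Rightarrow> real \<Rightarrow> real \<Rightarrow> real" where
  "Vf a c x = c / r * (1 - 1 / exp (la c * x)) + a * (exp (th c * x) - 1 / exp (la c * x))"
definition Vx :: "real \<Rightarrow> real \<Rightarrow> real \<Rightarrow> real" where
  "Vx a c x = (c / r + a) * la c / exp (la c * x) + a * th c * exp (th c * x)"
definition Vxx :: "real \<Rightarrow> real \<Rightarrow> real \<Rightarrow> real" where
  "Vxx a c x = - (c / r + a) * (la c)\<^sup>2 / exp (la c * x) + a * (th c)\<^sup>2 * exp (th c * x)"
definition Uf :: "real \<Rightarrow> real \<Rightarrow> real \<Rightarrow> real \<Rightarrow> real" where
  "Uf a b c x = - (1 - 1 / exp (la c * x)) / r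
     + kap c * x * ((c / r + a) * la c / exp (la c * x) - a * th c * exp (th c * x))
     - b * (exp (th c * x) - 1 / exp (la c * x))"
definition Ux :: "real \<Rightarrow> real \<Rightarrow> real \<Rightarrow> real \<Rightarrow> real" where
  "Ux a b c x = - la c / exp (la c * x) / r
     + kap c * ((c / r + a) * la c / exp (la c * x) - a * th c * exp (th c * x))
     - kap c * x * ((c / r + a) * (la c)\<^sup>2 / exp (la c * x) + a * (th c)\<^sup>2 * exp (th c * x))
     - b * (th c * exp (th c * x) + la c / exp (la c * x))"
definition Jf :: "real \<Rightarrow> real \<Rightarrow> real \<Rightarrow> real" where
  "Jf a c x = (exp (la c * x) - 1) / la c + (1 / exp (th c * x) - 1) / th c
     - (c / r + a) * la c * (x - (1 - 1 / (exp (th c * x) * exp (la c * x))) / (th c + la c))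
     - a * th c * ((exp (th c * x) * exp (la c * x) - 1) / (th c + la c) - x)"
definition Jc :: "real \<Rightarrow> real \<Rightarrow> real \<Rightarrow> real \<Rightarrow> real" where
  "Jc a b c x = kap c * ((exp (la c * x) - 1) / la c - x * exp (la c * x))
     - kap c * (x / exp (th c * x) + (1 / exp (th c * x) - 1) / th c)
     - ((1 / r + b) * la c - (c / r + a) * kap c * la c)
       * (x - (1 - 1 / (exp (th c * x) * exp (la c * x))) / (th c + la c))
     - (c / r + a) * la c * (kap c * (th c - la c))
       * ((1 - 1 / (exp (th c * x) * exp (la c * x))) / (th c + la c)\<^sup>2
          - x / (exp (th c * x) * exp (la c * x)) / (th c + la c))
     - (b * th c + a * kap c * th c) * ((exp (th c * x) * exp (la c * x) - 1) / (th c + la c) - x)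
     - a * th c * (kap c * (th c - la c))
       * (x * (exp (th c * x) * exp (la c * x)) / (th c + la c)
          - (exp (th c * x) * exp (la c * x) - 1) / (th c + la c)\<^sup>2)"

lemma exp_derivatives:
  "((\<lambda>x. exp (la c * x)) has_real_derivative exp (la c * x) * la c) (at x within S)"
  "((\<lambda>x. inverse (exp (la c * x))) has_real_derivative - (la c * inverse (exp (la c * x)))) (at x within S)"
  "((\<lambda>x. exp (th c * x)) has_real_derivative exp (th c * x) * th c) (at x within S)"
  "((\<lambda>x. inverse (exp (th c * x))) has_real_derivative - (th c * inverse (exp (th c * x)))) (at x within S)"
  by (rule derivative_eq_intros refl | simp)+

text \<open>For \<open>algebra\<close> reciprocals are independent unknowns; these relations tie
  them to the exponents and exponentials.\<close>

lemma exponent_inverses: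
  "la c * inverse (la c) = 1" "th c * inverse (th c) = 1" "(th c + la c) * inverse (th c + la c) = 1"
  "exp y * inverse (exp y) = (1::real)"
  using th_pos[of c] la_pos[of c] by auto

lemmas DERIV_rules = DERIV_add DERIV_diff DERIV_cmult DERIV_cmult_right DERIV_mult DERIV_minus
  DERIV_ident DERIV_const

lemma Vf_0 [simp]: "Vf a c 0 = 0" and Uf_0 [simp]: "Uf a b c 0 = 0"
  and Jf_0 [simp]: "Jf a c 0 = 0" and Jc_0 [simp]: "Jc a b c 0 = 0"
  by (simp_all add: Vf_def Uf_def Jf_def Jc_def)

lemma Vf_x: "(Vf a c has_real_derivative Vx a c x) (at x within S)"
  unfolding Vf_def Vx_def
  by (rule derivative_eq_intros refl | simp)+ (simp add: field_simps power2_eq_square)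

lemma Vx_x: "(Vx a c has_real_derivative Vxx a c x) (at x within S)"
  unfolding Vx_def Vxx_def using r_pos
  by - ((rule derivative_eq_intros refl | simp)+, simp add: field_simps power2_eq_square)

lemma Vxx_x: "(Vxx a c has_real_derivative th c * la c * Vx a c x - (la c - th c) * Vxx a c x) (at x within S)"
  unfolding Vx_def Vxx_def using r_pos
  by - ((rule derivative_eq_intros refl | simp)+, simp add: field_simps power2_eq_square)

lemma Vf_ode: "Vxx a c x + (la c - th c) * Vx a c x - th c * la c * Vf a c x = - (2 / \<sigma>\<^sup>2 * c)"
proof -
  have "Vxx a c x + (la c - th c) * Vx a c x - th c * la c * Vf a c x = - (th c * la c * (c / r))"
    unfolding Vf_def Vx_def Vxx_def using r_pos by (simp add: field_simps power2_eq_square)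
  then show ?thesis using r_pos by (simp add: th_times_la)
qed

lemma Uf_x: "(Uf a b c has_real_derivative Ux a b c x) (at x within S)"
  unfolding Uf_def Ux_def using r_pos
  by - ((rule derivative_eq_intros refl | simp)+, simp add: algebra_simps power2_eq_square)

text \<open>The \<open>c\<close>-derivative of the equation for \<open>Vf\<close>: the drift
  \<open>\<mu> - c\<close> contributes \<open>Vx\<close> and the right-hand side contributes
  1.\<close>

lemma Ux_x: "(Ux a b c has_real_derivative
  2 / \<sigma>\<^sup>2 * (1 - Vx a c x) - (la c - th c) * Ux a b c x + th c * la c * Uf a b c x) (at x within S)"
proof -
  \<comment> \<open>Both sides equal \<open>2 / \<sigma>\<^sup>2\<close>. Given this relation, the
    claim is a polynomial identity.\<close>
  have s: "th c * la c * inverse r = kap c * (th c + la c)"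
    using th_times_la[of c] kap_eq[of c] r_pos by (simp add: field_simps)
  show ?thesis
    unfolding kap_eq[of c, symmetric]
    unfolding Ux_def Uf_def Vx_def divide_inverse mult_1_left
    apply (rule DERIV_cong)
     apply ((rule DERIV_rules exp_derivatives)+)[1]
    using s
    apply algebra
    done
qed

lemma Jf_x: "(Jf a c has_real_derivative psi c x * (1 - Vx a c x)) (at x within S)"
  unfolding Jf_def psi_def Vx_def divide_inverse mult_1_left inverse_mult_distrib
  apply (rule DERIV_cong)
   apply ((rule DERIV_rules exp_derivatives)+)[1]
  using exponent_inverses(1-3)[of c] exponent_inverses(4)[of "la c * x"] exponent_inverses(4)[of "th c * x"]
  apply algebra
  done

lemma psi_x: "(psi c has_real_derivative la c * exp (la c * x) + th c / exp (th c * x)) (at x within S)"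
  unfolding psi_def divide_inverse mult_1_left
  apply (rule DERIV_cong)
   apply ((rule DERIV_rules exp_derivatives)+)[1]
  apply algebra
  done

text \<open>The \<open>c\<close>-derivative of \<open>psi\<close>; \<open>psicx\<close> is the mixed
  derivative.\<close>

definition psic :: "real \<Rightarrow> real \<Rightarrow> real" where
  "psic c x = kap c * x * (th c / exp (th c * x) - la c * exp (la c * x))"
definition psicx :: "real \<Rightarrow> real \<Rightarrow> real" where
  "psicx c x = kap c * (th c / exp (th c * x) - la c * exp (la c * x))
    - kap c * x * ((th c)\<^sup>2 / exp (th c * x) + (la c)\<^sup>2 * exp (la c * x))"

lemma psic_x: "(psic c has_real_derivative psicx c x) (at x within S)"
  unfolding psic_def psicx_def divide_inverse mult_1_left
  apply (rule DERIV_cong)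
   apply ((rule DERIV_rules exp_derivatives)+)[1]
  apply algebra
  done

text \<open>The adjoint equation of \<open>psi\<close> differentiated in \<open>c\<close>. As
  \<open>th c * la c\<close> does not depend on \<open>c\<close>, the extra term comes only from
  \<open>la c - th c\<close>, whose derivative is \<open>- 2 / \<sigma>\<^sup>2\<close>.\<close>

lemma psicx_x: "(psicx c has_real_derivative
    (la c - th c) * psicx c x + th c * la c * psic c x
    - 2 / \<sigma>\<^sup>2 * (la c * exp (la c * x) + th c / exp (th c * x))) (at x within S)"
  unfolding psic_def psicx_def divide_inverse mult_1_left
  apply (rule DERIV_cong)
   apply ((rule DERIV_rules exp_derivatives)+)[1]
  using kap_eq[of c]
  unfolding divide_inverse
  apply algebra
  done

lemma Jc_x: "(Jc a b c has_real_derivative psic c x * (1 - Vx a c x) + psi c x * Ux a b c x) (at x within S)"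
  unfolding Jc_def psi_def psic_def Ux_def Vx_def divide_inverse mult_1_left inverse_mult_distrib power_inverse[symmetric]
  apply (rule DERIV_cong)
   apply ((rule DERIV_rules exp_derivatives)+)[1]
  using exponent_inverses(1-3)[of c] exponent_inverses(4)[of "la c * x"] exponent_inverses(4)[of "th c * x"]
  apply algebra
  done

section \<open>Derivatives of the explicit families with respect to \<open>c\<close>\<close>

lemma exponent_c_derivatives:
  "((\<lambda>c. exp (la c * x)) has_real_derivative - (kap c * la c * x * exp (la c * x))) (at c within S)"
  "((\<lambda>c. inverse (exp (la c * x))) has_real_derivative kap c * la c * x * inverse (exp (la c * x))) (at c within S)"
  "((\<lambda>c. exp (th c * x)) has_real_derivative kap c * th c * x * exp (th c * x)) (at c within S)"
  "((\<lambda>c. inverse (exp (th c * x))) has_real_derivative - (kap c * th c * x * inverse (exp (th c * x)))) (at c within S)"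
  "((\<lambda>c. inverse (la c)) has_real_derivative kap c * inverse (la c)) (at c within S)"
  "((\<lambda>c. inverse (th c)) has_real_derivative - (kap c * inverse (th c))) (at c within S)"
  "((\<lambda>c. inverse (th c + la c)) has_real_derivative
    - (kap c * (th c - la c) * (inverse (th c + la c))\<^sup>2)) (at c within S)"
  "(th has_real_derivative kap c * th c) (at c within S)"
  "(la has_real_derivative - (kap c * la c)) (at c within S)"
proof -
  have "((\<lambda>c. th c + la c) has_real_derivative kap c * (th c - la c)) (at c within S)"
    using DERIV_add[OF th_derivative[of c] la_derivative[of c]] by (simp add: algebra_simps)
  then show "((\<lambda>c. inverse (th c + la c)) has_real_derivative
      - (kap c * (th c - la c) * (inverse (th c + la c))\<^sup>2)) (at c within S)"
    using th_pos[of c] la_pos[of c]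
    by (intro DERIV_cong[OF DERIV_inverse_fun]) (auto simp: power_inverse power2_eq_square)
qed (use th_pos[of c] la_pos[of c] in \<open>auto intro!: derivative_eq_intros th_derivative la_derivative
  simp: field_simps power2_eq_square\<close>)

lemma Vf_c:
  assumes "(A has_real_derivative b) (at c within S)"
  shows "((\<lambda>c. Vf (A c) c x) has_real_derivative - Uf (A c) b c x) (at c within S)"
  unfolding Vf_def Uf_def divide_inverse mult_1_left
  apply (rule DERIV_cong)
   apply ((rule assms DERIV_rules exponent_c_derivatives)+)[1]
  apply algebra
  done

lemma Vx_c:
  assumes "(A has_real_derivative b) (at c within S)"
  shows "((\<lambda>c. Vx (A c) c x) has_real_derivative - Ux (A c) b c x) (at c within S)"
  unfolding Vx_def Ux_def divide_inverse mult_1_left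
  apply (rule DERIV_cong)
   apply ((rule assms DERIV_rules exponent_c_derivatives)+)[1]
  apply algebra
  done

lemma Jf_c:
  assumes "(A has_real_derivative b) (at c within S)"
  shows "((\<lambda>c. Jf (A c) c x) has_real_derivative Jc (A c) b c x) (at c within S)"
  unfolding Jf_def Jc_def divide_inverse mult_1_left inverse_mult_distrib power_inverse[symmetric]
  apply (rule DERIV_cong)
   apply ((rule assms DERIV_rules exponent_c_derivatives)+)[1]
  using exponent_inverses(1-3)[of c] exponent_inverses(4)[of "la c * x"] exponent_inverses(4)[of "th c * x"]
  apply algebra
  done

end

subsection \<open>First consequences of the equations\<close>

lemma at_within_nonneg_neq_bot: "0 \<le> x \<Longrightarrow> at x within {0..} \<noteq> (bot :: real filter)"
proof -
  assume "0 \<le> x"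
  then have "at x within {x<..} \<le> at x within {0..}" by (intro at_le) auto
  then show ?thesis by (metis bot.extremum_uniqueI trivial_limit_at_right_real)
qed

lemma has_real_derivative_partial_x:
  assumes "x_differentiable_at w x c"
  shows "((\<lambda>y. w y c) has_real_derivative partial_x w x c) (at x within {0..})"
  using assms unfolding x_differentiable_at_def partial_x_def
  by (simp add: has_real_derivative_iff_has_vector_derivative vector_derivative_works)

lemma partial_x_eqI:
  assumes "((\<lambda>y. w y c) has_real_derivative d) (at x within {0..})" "0 \<le> x"
  shows "partial_x w x c = d"
  using assms unfolding partial_x_def has_real_derivative_iff_has_vector_derivative
  by (intro vector_derivative_within at_within_nonneg_neq_bot)

lemma continuous_bounded_bound:
  assumes "continuous_bounded cb w"
  obtains M where "\<And>x c. 0 \<le> x \<Longrightarrow> c \<in> {0..cb} \<Longrightarrow> \<bar>w x c\<bar> \<le> M"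
  using assms unfolding continuous_bounded_def state_space_def bounded_iff by fastforce

lemma continuous_bounded_compose:
  assumes "continuous_bounded cb w" "continuous_on S f" "continuous_on S g"
    "\<And>t. t \<in> S \<Longrightarrow> 0 \<le> f t \<and> g t \<in> {0..cb}"
  shows "continuous_on S (\<lambda>t. w (f t) (g t))"
proof -
  have "continuous_on ({0..} \<times> {0..cb}) (\<lambda>(x, c). w x c)"
    using assms(1) by (simp add: continuous_bounded_def state_space_def)
  moreover have "(\<lambda>t. (f t, g t)) ` S \<subseteq> {0..} \<times> {0..cb}" using assms(4) by auto
  ultimately show ?thesis
    using continuous_on_compose2[of _ "\<lambda>(x, c). w x c" S "\<lambda>t. (f t, g t)"] assms(2,3)
    by (simp add: continuous_on_Pair)
qed

section \<open>The solution pair: representation, regularity and the equations in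
  \<open>x\<close>\<close>

locale ratcheting = characteristic +
  fixes cb :: real and v u :: "real \<Rightarrow> real \<Rightarrow> real"
  assumes mu_pos: "\<mu> > 0" and cb_nonneg: "0 \<le> cb"
    and large: "2 * \<mu> * cb > \<sigma>\<^sup>2 * r"
    and solution: "solution_pair \<mu> \<sigma> r cb v u"
begin

abbreviation "vx \<equiv> partial_x v"
abbreviation "ux \<equiv> partial_x u"

lemma cb_pos: "0 < cb"
proof -
  have "0 < \<sigma>\<^sup>2 * r" using \<sigma>_pos r_pos by simp
  with large have "0 < 2 * \<mu> * cb" by linarith
  then show ?thesis using mu_pos by (simp add: zero_less_mult_iff)
qed

lemma v_eq: "0 \<le> x \<Longrightarrow> c \<in> {0..cb} \<Longrightarrow> v x c = gfun \<mu> \<sigma> r cb x + integral {c..cb} (\<lambda>s. u x s)"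
  using solution unfolding solution_pair_def by blast

lemma v_regular: "continuous_bounded cb v" "continuous_bounded cb vx"
  and v_zero: "c \<in> {0..cb} \<Longrightarrow> v 0 c = 0"
  and v_top: "0 \<le> x \<Longrightarrow> v x cb = gfun \<mu> \<sigma> r cb x"
  using solution unfolding solution_pair_def HJB_solution_def by blast+

lemma v_deriv:
  assumes "0 \<le> x" "c \<in> {0..cb}"
  shows "((\<lambda>y. v y c) has_real_derivative vx x c) (at x within {0..})"
  using solution assms unfolding solution_pair_def HJB_solution_def
  by (intro has_real_derivative_partial_x) blast

lemma u_regular: "continuous_bounded cb u" "continuous_bounded cb ux"
  and u_zero: "c \<in> {0..cb} \<Longrightarrow> u 0 c = 0"
  and u_nonneg: "0 \<le> x \<Longrightarrow> c \<in> {0..cb} \<Longrightarrow> 0 \<le> u x c"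
  using solution unfolding solution_pair_def obstacle_solution_def by blast+

lemma u_deriv:
  assumes "0 \<le> x" "c \<in> {0..cb}"
  shows "((\<lambda>y. u y c) has_real_derivative ux x c) (at x within {0..})"
  using solution assms unfolding solution_pair_def obstacle_solution_def
  by (intro has_real_derivative_partial_x) blast

lemmas vx_continuous = continuous_bounded_compose[OF v_regular(2)]
lemmas u_continuous = continuous_bounded_compose[OF u_regular(1)]
lemmas ux_continuous = continuous_bounded_compose[OF u_regular(2)]

lemma estimate:
  obtains K where "K > 0" "\<forall>x\<ge>0. \<forall>c\<in>{0..cb}.
      0 \<le> v x c \<and> v x c \<le> cb / r \<and> 0 \<le> vx x c \<and> vx x c \<le> K \<and>
      0 \<le> - partial_c cb v x c \<and> - partial_c cb v x c \<le> K \<and>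
      (\<forall>y\<ge>x. vx y c \<le> max (vx x c) 1) \<and>
      C1alpha_norm (1/2) (\<lambda>z. u z c) \<le> ereal K \<and>
      c_differentiable_at cb u x c \<and> \<bar>partial_c cb u x c\<bar> \<le> K"
proof -
  have "estimates r cb v u" using solution by (simp add: solution_pair_def)
  then have "0 < (1/2 :: real) \<and> (1/2 :: real) < 1 \<longrightarrow> (\<exists>K>0. \<forall>x\<ge>0. \<forall>c\<in>{0..cb}.
      0 \<le> v x c \<and> v x c \<le> cb / r \<and> 0 \<le> vx x c \<and> vx x c \<le> K \<and>
      0 \<le> - partial_c cb v x c \<and> - partial_c cb v x c \<le> K \<and>
      (\<forall>y\<ge>x. vx y c \<le> max (vx x c) 1) \<and>
      C1alpha_norm (1/2) (\<lambda>z. u z c) \<le> ereal K \<and>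
      c_differentiable_at cb u x c \<and> \<bar>partial_c cb u x c\<bar> \<le> K)"
    unfolding estimates_def by (rule spec)
  then show thesis using that by auto
qed

lemma v_bounds: "0 \<le> x \<Longrightarrow> c \<in> {0..cb} \<Longrightarrow> 0 \<le> v x c \<and> v x c \<le> cb / r"
  using estimate by metis

lemma vx_le_1:
  assumes "0 \<le> x" "x \<le> y" "c \<in> {0..cb}" "vx x c \<le> 1"
  shows "vx y c \<le> 1"
proof -
  have "vx y c \<le> max (vx x c) 1" using assms(1-3) by (metis estimate)
  with assms(4) show ?thesis by simp
qed

lemma v_c:
  assumes x: "0 \<le> x" and c: "c \<in> {0..cb}"
  shows "((\<lambda>s. v x s) has_real_derivative - u x c) (at c within {0..cb})"
proof -
  have "continuous_on {0..cb} (\<lambda>s. u x s)" using x by (intro u_continuous continuous_intros) auto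
  from integral_has_real_derivative'[OF this c]
  have "((\<lambda>s. gfun \<mu> \<sigma> r cb x + integral {s..cb} (\<lambda>s. u x s)) has_real_derivative - u x c) (at c within {0..cb})"
    by (auto intro!: derivative_eq_intros)
  then show ?thesis
    by (rule has_field_derivative_transform_within[OF _ zero_less_one]) (use c v_eq[OF x] in auto)
qed

lemma partial_c_v:
  assumes "0 \<le> x" "c \<in> {0..cb}"
  shows "partial_c cb v x c = - u x c"
  using v_c[OF assms] vector_derivative_within_closed_interval[OF cb_pos assms(2)]
  unfolding partial_c_def has_real_derivative_iff_has_vector_derivative by blast

lemma gam_eq: "gam \<mu> \<sigma> r cb = la cb"
  by (simp add: gam_def la_def disc_def add.commute)

lemma gfun_eq: "gfun \<mu> \<sigma> r cb x = Vf 0 cb x"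
  by (simp add: gfun_def Vf_def gam_eq exp_minus inverse_eq_divide)

text \<open>Together with \<open>deriv_gfun\<close> this replaces the nonlocal term of the obstacle
  equation by \<open>vx\<close>. For fixed \<open>c\<close> the functions \<open>v\<close> and
  \<open>u\<close> thus satisfy a triangular system of ordinary differential equations.\<close>

lemma vx_eq:
  assumes x: "0 \<le> x" and c: "c \<in> {0..cb}"
  shows "vx x c = Vx 0 cb x + integral {c..cb} (\<lambda>s. ux x s)"
proof (rule partial_x_eqI[OF _ x])
  have "((\<lambda>x. integral (cbox c cb) (\<lambda>s. u x s)) has_real_derivative integral (cbox c cb) (\<lambda>s. ux x s))
      (at x within {0..})"
  proof (rule leibniz_rule_field_derivative)
    show "continuous_on ({0..} \<times> cbox c cb) (\<lambda>(x, s). ux x s)"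
      using c u_regular(2) unfolding continuous_bounded_def state_space_def
      by (auto elim!: continuous_on_subset)
    show "(\<lambda>s. u x s) integrable_on cbox c cb" if "x \<in> {0..}" for x
      using that c by (intro integrable_continuous u_continuous continuous_intros) auto
  qed (use x c u_deriv in auto)
  then have "((\<lambda>x. Vf 0 cb x + integral {c..cb} (\<lambda>s. u x s)) has_real_derivative
      Vx 0 cb x + integral {c..cb} (\<lambda>s. ux x s)) (at x within {0..})"
    by (intro DERIV_add Vf_x) auto
  then show "((\<lambda>y. v y c) has_real_derivative Vx 0 cb x + integral {c..cb} (\<lambda>s. ux x s)) (at x within {0..})"
    by (rule has_field_derivative_transform_within[OF _ zero_less_one])
      (use x c v_eq gfun_eq in auto)
qed

text \<open>Since \<open>u\<close> is nonnegative and 0 at \<open>x = 0\<close>, its slope there is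
  nonnegative, so \<open>vx 0 c\<close> is at least the slope \<open>cb / r * la cb\<close> of
  \<open>g\<close>. That this exceeds 1 is where
  \<open>2 * \<mu> * cb > \<sigma>\<^sup>2 * r\<close> enters.\<close>

lemma vx_at_0: 
  assumes c: "c \<in> {0..cb}"
  shows "1 < vx 0 c"
proof -
  have "0 \<le> integral {c..cb} (\<lambda>s. ux 0 s)"
  proof (rule integral_nonneg)
    show "(\<lambda>s. ux 0 s) integrable_on {c..cb}"
      using c by (intro integrable_continuous_real ux_continuous continuous_intros) auto
    show "0 \<le> ux 0 s" if "s \<in> {c..cb}" for s
      by (rule derivative_nonneg_at_zero[OF u_deriv]) (use that c u_zero u_nonneg in auto)
  qed
  moreover have "1 < cb / r * la cb"
  proof (rule ccontr)
    assume "\<not> ?thesis"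
    then have le: "la cb * cb \<le> r" using r_pos by (simp add: field_simps)
    \<comment> \<open>The quadratic equation of \<open>la cb\<close>. Multiplied by
      \<open>cb\<close> and combined twice with \<open>la cb * cb \<le> r\<close>, it yields
      \<open>2 * \<mu> * cb \<le> \<sigma>\<^sup>2 * r\<close>.\<close>
    have "la cb * (la cb - 2 / \<sigma>\<^sup>2 * (\<mu> - cb)) = 2 / \<sigma>\<^sup>2 * r"
      using th_times_la[of cb] la_minus_th[of cb] by (simp add: algebra_simps)
    then have "\<sigma>\<^sup>2 * la cb * la cb = 2 * (\<mu> - cb) * la cb + 2 * r"
      using \<sigma>_pos by (simp add: field_simps power2_eq_square)
    then have "\<sigma>\<^sup>2 * la cb * (la cb * cb) = 2 * (\<mu> - cb) * la cb * cb + 2 * r * cb"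
      by algebra
    moreover have "\<sigma>\<^sup>2 * la cb * (la cb * cb) \<le> \<sigma>\<^sup>2 * la cb * r"
      using le la_pos[of cb] by (intro mult_left_mono) auto
    moreover have "cb * (la cb * cb) \<le> cb * r"
      using le cb_nonneg by (intro mult_left_mono) auto
    ultimately have "la cb * (2 * \<mu> * cb) \<le> la cb * (\<sigma>\<^sup>2 * r)"
      by (simp add: algebra_simps)
    then show False using large la_pos[of cb] by simp
  qed
  moreover have "Vx 0 cb 0 = cb / r * la cb" by (simp add: Vx_def)
  ultimately show ?thesis using vx_eq[OF _ c, of 0] by simp
qed

lemma deriv_gfun: "deriv (gfun \<mu> \<sigma> r cb) x = Vx 0 cb x"
proof -
  have "gfun \<mu> \<sigma> r cb = Vf 0 cb" using gfun_eq by auto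
  then show ?thesis using Vf_x[of 0 cb x UNIV] by (simp add: DERIV_imp_deriv)
qed

lemma normalize:
  "1/2 * \<sigma>\<^sup>2 * h2 + (\<mu> - c) * h1 - r * h = q \<longleftrightarrow> h2 + (la c - th c) * h1 - th c * la c * h = 2 / \<sigma>\<^sup>2 * q"
proof -
  have "2 / \<sigma>\<^sup>2 * (1/2 * \<sigma>\<^sup>2 * h2 + (\<mu> - c) * h1 - r * h) = h2 + (la c - th c) * h1 - th c * la c * h"
    unfolding la_minus_th th_times_la using \<sigma>_pos by (simp add: field_simps)
  moreover have "(2 / \<sigma>\<^sup>2 * a = 2 / \<sigma>\<^sup>2 * b) = (a = b)" for a b
    using \<sigma>_pos by simp
  ultimately show ?thesis by metis
qed

lemma v_ode:
  assumes "0 \<le> y" "y \<le> x" "c \<in> {0..cb}" "0 < u x c"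
  shows "((\<lambda>y. vx y c) has_real_derivative
    - (2 / \<sigma>\<^sup>2 * c) - (la c - th c) * vx y c + th c * la c * v y c) (at y within {0..})"
proof -
  have "partial_c cb v x c < 0" using assms partial_c_v[of x c] by simp
  then have "x_differentiable_at vx y c \<and> - Lop \<mu> \<sigma> r c v (partial_x vx y c) y - c = 0"
    using solution assms unfolding solution_pair_def HJB_solution_def
    by (meson atLeastAtMost_iff order_trans)
  then show ?thesis
    using normalize[of "partial_x vx y c" c "vx y c" "v y c" "- c"]
    by (intro DERIV_cong[OF has_real_derivative_partial_x]) (auto simp: Lop_def algebra_simps)
qed

lemma u_ode:
  assumes "0 \<le> y" "y \<le> x" "c \<in> {0..cb}" "0 < u x c"
  shows "((\<lambda>y. ux y c) has_real_derivative
    2 / \<sigma>\<^sup>2 * (1 - vx y c) - (la c - th c) * ux y c + th c * la c * u y c) (at y within {0..})"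
proof -
  have "x_differentiable_at ux y c \<and> obstacle_expr \<mu> \<sigma> r cb u (partial_x ux y c) y c = 0"
    using solution assms unfolding solution_pair_def obstacle_solution_def
    by (meson atLeastAtMost_iff order_trans)
  then show ?thesis
    using normalize[of "partial_x ux y c" c "ux y c" "u y c" "1 - vx y c"] vx_eq[of y c] assms(1,3)
    by (intro DERIV_cong[OF has_real_derivative_partial_x])
      (auto simp: obstacle_expr_def deriv_gfun Lop_def algebra_simps diff_divide_distrib add_divide_distrib)
qed

end

subsection \<open>The zero set of \<open>u\<close>\<close>

lemma at_within_nonneg_eq: "0 < x \<Longrightarrow> at x within {0..} = at (x::real)"
  by (rule at_within_interior) (simp add: interior_real_atLeast)

lemma (in characteristic) hom_at_top: "filterlim (hom c) at_top at_top"
proof (rule filterlim_at_top_mono)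
  show "filterlim (\<lambda>y. exp (th c * y) - 1) at_top at_top" using th_pos[of c] by real_asymp
  have "1 / exp (la c * y) \<le> 1" if "0 < y" for y using la_pos[of c] that by simp
  then show "\<forall>\<^sub>F y in at_top. exp (th c * y) - 1 \<le> hom c y"
    unfolding hom_def by (intro eventually_mono[OF eventually_gt_at_top[of 0]]) auto
qed

text \<open>Boundedness excludes the exponentially growing solution; applied below to the
  coefficients of both \<open>v\<close> and \<open>u\<close>.\<close>

lemma (in characteristic) hom_multiple_bounded:
  assumes "\<And>y. 0 \<le> y \<Longrightarrow> \<bar>a * hom c y\<bar> \<le> M"
  shows "a = 0"
proof (rule ccontr)
  assume a: "a \<noteq> 0"
  obtain y where y: "0 \<le> y" "(\<bar>M\<bar> + 1) / \<bar>a\<bar> \<le> hom c y"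
    using hom_at_top[of c] unfolding filterlim_at_top eventually_at_top_linorder by (metis linear)
  then have "\<bar>M\<bar> + 1 \<le> \<bar>a\<bar> * hom c y" using a by (simp add: pos_divide_le_eq mult.commute)
  also have "\<dots> \<le> \<bar>a * hom c y\<bar>" by (simp add: abs_mult mult_left_mono)
  finally show False using assms[OF y(1)] by simp
qed

context ratcheting
begin

text \<open>The points of \<open>[0, 1] \<times> [0, cb]\<close> with \<open>vx \<le> 1\<close> form
  a compact set that avoids \<open>x = 0\<close>; half of its least first coordinate works for every
  \<open>c\<close>.\<close>

lemma vx_gt_1_near_0:
  obtains e where "0 < e" "\<And>x c. 0 \<le> x \<Longrightarrow> x \<le> e \<Longrightarrow> c \<in> {0..cb} \<Longrightarrow> 1 < vx x c"
proof -
  let ?Q = "{0..1} \<times> {0..cb}"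
  let ?Z = "?Q \<inter> (\<lambda>p. vx (fst p) (snd p)) -` {..1}"
  have "continuous_on ?Q (\<lambda>p. vx (fst p) (snd p))"
    by (intro vx_continuous continuous_intros) auto
  then have "closed ?Z" by (rule continuous_closed_preimage) (auto intro: closed_Times)
  then have "compact (?Q \<inter> ?Z)" by (intro compact_Int_closed compact_Times) auto
  then have cpt: "compact ?Z" by (simp add: Int_assoc[symmetric])
  show thesis
  proof (cases "?Z = {}")
    case True
    then show thesis by (intro that[of 1]) (force simp: not_le[symmetric])+
  next
    case False
    then obtain p where p: "p \<in> ?Z" "\<And>q. q \<in> ?Z \<Longrightarrow> fst p \<le> fst q"
      using continuous_attains_inf[OF cpt _ continuous_on_fst[OF continuous_on_id]] by auto
    have "fst p \<noteq> 0" using p(1) vx_at_0[of "snd p"] by auto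
    then have p0: "0 < fst p" using p(1) by auto
    show thesis
    proof (rule that[of "fst p / 2"])
      fix x c assume "0 \<le> x" "x \<le> fst p / 2" "c \<in> {0..cb}"
      then show "1 < vx x c" using p(1) p(2)[of "(x, c)"] p0 by (force simp: not_le[symmetric])
    qed (use p0 in simp)
  qed
qed

text \<open>The zero is a minimum of \<open>u\<close>, and because \<open>u\<close> is positive
  further right the equation holds at \<open>z\<close>. There it reduces to
  \<open>u_xx = 2 / \<sigma>\<^sup>2 * (1 - vx)\<close>, which cannot be negative.\<close>

lemma u_zero_interior:
  assumes "0 < z" "z < x" "c \<in> {0..cb}" "u z c = 0" "0 < u x c"
  shows "ux z c = 0" "vx z c \<le> 1"
proof -
  have d: "((\<lambda>y. u y c) has_real_derivative ux y c) (at y)" if "0 < y" for y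
    using u_deriv[of y c] that assms by (simp add: at_within_nonneg_eq)
  have nn: "0 \<le> u y c" if "0 < y" for y using u_nonneg that assms by simp
  show 0: "ux z c = 0"
    by (rule zero_of_nonneg_derivatives(1)[OF d nn assms(1,4)])
  have "((\<lambda>y. ux y c) has_real_derivative 2 / \<sigma>\<^sup>2 * (1 - vx z c)) (at z)"
    using u_ode[of z x c] assms 0 by (simp add: at_within_nonneg_eq)
  then have "0 \<le> 2 / \<sigma>\<^sup>2 * (1 - vx z c)"
    using zero_of_nonneg_derivatives(2)[where f="\<lambda>y. u y c" and f'="\<lambda>y. ux y c" and z=z] d nn assms(1,4)
    by blast
  then show "vx z c \<le> 1" using \<sigma>_pos by (simp add: zero_le_mult_iff zero_le_divide_iff)
qed

text \<open>A zero followed by a positive value contradicts \<open>u_zero_interior\<close>, as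
  \<open>vx > 1\<close> here. If \<open>u\<close> vanishes from \<open>x\<close> on, the
  almost-everywhere inequality makes the weak second derivative of the zero function negative on
  \<open>(x, e)\<close>.\<close>

lemma u_pos_near_0:
  assumes e: "\<And>x c. 0 \<le> x \<Longrightarrow> x \<le> e \<Longrightarrow> c \<in> {0..cb} \<Longrightarrow> 1 < vx x c"
    and x: "0 < x" "x < e" and c: "c \<in> {0..cb}"
  shows "0 < u x c"
proof (rule ccontr)
  assume "\<not> 0 < u x c"
  then have ux0: "u x c = 0" using u_nonneg[of x c] x c by simp
  show False
  proof (cases "\<exists>y>x. 0 < u y c")
    case True
    then show False using u_zero_interior(2)[OF x(1) _ c ux0] e[of x c] x c by force
  next
    case False
    then have z: "u y c = 0" if "x \<le> y" for y
    proof -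
      have "\<not> 0 < u y c" using False ux0 that by (cases "y = x") auto
      then show ?thesis using u_nonneg[of y c] that x c by simp
    qed
    obtain uxx where w: "weak_second_derivative_on {0<..} (\<lambda>x. u x c) uxx"
      and ae: "AE x in lebesgue_on {0..}. 0 \<le> obstacle_expr \<mu> \<sigma> r cb u (uxx x) x c"
      using solution c unfolding solution_pair_def obstacle_solution_def by blast
    have "AE y in lebesgue_on {0..}. x < y \<and> y < e \<longrightarrow> uxx y < 0"
      using ae
    proof eventually_elim
      case (elim y)
      show ?case
      proof
        assume y: "x < y \<and> y < e"
        have "((\<lambda>_. 0) has_real_derivative 0) (at y)" by simp
        then have "((\<lambda>y. u y c) has_real_derivative 0) (at y)"
          by (rule has_field_derivative_transform_within_open[where S="{x<..}"]) (use y z in auto)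
        then have "ux y c = 0"
          using u_deriv[of y c] x y c by (auto simp: at_within_nonneg_eq intro: DERIV_unique)
        moreover have "deriv (gfun \<mu> \<sigma> r cb) y + integral {c..cb} (\<lambda>s. ux y s) = vx y c"
          using vx_eq[of y c] deriv_gfun x y c by simp
        ultimately have "1 / 2 * \<sigma>\<^sup>2 * uxx y \<le> 1 - vx y c"
          using elim z[of y] y by (simp add: obstacle_expr_def Lop_def)
        moreover have "1 < vx y c" using e[of y c] x y c by auto
        ultimately have "\<sigma>\<^sup>2 * uxx y < 0" by simp
        then show "uxx y < 0" using \<sigma>_pos by (simp add: mult_less_0_iff)
      qed
    qed
    then show False
      using weak_second_derivative_not_negative[OF w x(1) x(2)] z by auto
  qed
qed

lemma wronskian_u:
  assumes "0 \<le> y" "y \<le> x" "c \<in> {0..cb}" "0 < u x c"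
  shows "((\<lambda>y. psi c y * ux y c - chi c y * u y c) has_real_derivative
    psi c y * (2 / \<sigma>\<^sup>2 * (1 - vx y c))) (at y within {0..})"
  by (rule DERIV_cong[OF wronskian_derivative[OF u_deriv u_ode[OF assms]]]) (use assms in auto)

text \<open>Past a zero of \<open>u\<close> the quotient \<open>u / hom\<close> is nondecreasing, so \<open>u\<close> could only become positive
  again by growing exponentially.\<close>

lemma u_zero_persists:
  assumes z: "0 < z" "u z c = 0" and c: "c \<in> {0..cb}" and x: "z \<le> x"
  shows "u x c = 0"
proof (rule ccontr)
  assume "u x c \<noteq> 0"
  then have ux: "0 < u x c" "z < x" using u_nonneg[of x c] z x c by (auto simp: less_le)
  note z' = u_zero_interior[OF z(1) ux(2) c z(2) ux(1)]
  \<comment> \<open>The one-sided estimate on \<open>vx\<close> carries the bound at the zero to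
    everything on its right; this fixes the sign of the Wronskian's derivative.\<close>
  have v1: "vx y c \<le> 1" if "z \<le> y" for y
    using vx_le_1[OF _ that c z'(2)] z by simp
  let ?K = "\<lambda>y. psi c y * ux y c - chi c y * u y c"
  have mono: "u y c / hom c y \<le> u y' c / hom c y'" if "z \<le> y" "y \<le> y'" "0 < u y' c" for y y'
  proof -
    have K: "0 \<le> ?K w" if w: "z \<le> w" "w \<le> y'" for w
    proof -
      have "?K z \<le> ?K w"
        using w(1)
      proof (rule DERIV_nonneg_imp_nondecreasing)
        fix t assume t: "z \<le> t" "t \<le> w"
        then have "(?K has_real_derivative psi c t * (2 / \<sigma>\<^sup>2 * (1 - vx t c))) (at t)"
          using wronskian_u[of t y' c] w \<open>0 < u y' c\<close> z c by (simp add: at_within_nonneg_eq)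
        moreover have "0 \<le> psi c t * (2 / \<sigma>\<^sup>2 * (1 - vx t c))"
          using v1[of t] t psi_pos[of t c] z by simp
        ultimately show "\<exists>y. (?K has_real_derivative y) (at t) \<and> 0 \<le> y" by blast
      qed
      then show ?thesis using z' z by simp
    qed
    show ?thesis
      using that(2)
    proof (rule DERIV_nonneg_imp_nondecreasing)
      fix t assume t: "y \<le> t" "t \<le> y'"
      then have "0 < t" using that z by linarith
      then have "((\<lambda>y. u y c / hom c y) has_real_derivative ?K t * (exp (th c * t) / exp (la c * t)) / (hom c t)\<^sup>2) (at t)"
        using quotient_hom_derivative[where h="\<lambda>y. u y c" and ?h1.0="\<lambda>y. ux y c", OF u_deriv[of t c]] c by (simp add: at_within_nonneg_eq)
      moreover have "0 \<le> ?K t * (exp (th c * t) / exp (la c * t)) / (hom c t)\<^sup>2"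
        using K[of t] t that by simp
      ultimately show "\<exists>d. ((\<lambda>y. u y c / hom c y) has_real_derivative d) (at t) \<and> 0 \<le> d" by blast
    qed
  qed
  have h: "0 < hom c y" if "z \<le> y" for y using that z hom_pos by simp
  \<comment> \<open>At a first zero \<open>w\<close> beyond \<open>x\<close> the nondecreasing
    quotient would drop to 0. Monotonicity is available only up to points where \<open>u\<close> is
    positive, hence the left limit at \<open>w\<close>.\<close>
  have pos: "0 < u y c" if "x \<le> y" for y
  proof (rule ccontr)
    assume "\<not> 0 < u y c"
    then have "u y c = 0" using u_nonneg[of y c] \<open>x \<le> y\<close> z x c by simp
    have "continuous_on {x..y} (\<lambda>y. u y c)"
      using z x c by (intro u_continuous continuous_intros) auto
    then obtain w where w: "w \<in> {x..y}" "u w c = 0" "\<And>t. x \<le> t \<Longrightarrow> t < w \<Longrightarrow> 0 < u t c"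
      by (rule first_zero[where f="\<lambda>y. u y c"]) (use z x c u_nonneg \<open>x \<le> y\<close> \<open>u y c = 0\<close> in auto)
    have xw: "x < w" using w ux by (cases "x = w") auto
    have "((\<lambda>y. u y c / hom c y) \<longlongrightarrow> u w c / hom c w) (at w)"
    proof -
      have "isCont (\<lambda>y. u y c) w"
        using u_deriv[of w c] w xw z x c by (auto simp: at_within_nonneg_eq intro: DERIV_isCont)
      moreover have "isCont (hom c) w" unfolding hom_def by (intro continuous_intros) auto
      ultimately show ?thesis using h[of w] xw x by (intro tendsto_divide) (auto simp: isCont_def)
    qed
    then have "((\<lambda>y. u y c / hom c y) \<longlongrightarrow> u w c / hom c w) (at_left w)"
      by (rule filterlim_mono) (auto intro: at_le)
    moreover have "\<forall>\<^sub>F t in at_left w. u x c / hom c x \<le> u t c / hom c t"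
      unfolding eventually_at_left_field using xw w(3) x mono[of x]
      by (intro exI[of _ x]) auto
    ultimately have "u x c / hom c x \<le> u w c / hom c w"
      by (rule tendsto_lowerbound) simp
    then show False using w(2) ux h[of x] x by (simp add: field_simps)
  qed
  obtain M where M: "\<And>x c. 0 \<le> x \<Longrightarrow> c \<in> {0..cb} \<Longrightarrow> \<bar>u x c\<bar> \<le> M"
    using continuous_bounded_bound[OF u_regular(1)] by blast
  let ?q = "u x c / hom c x"
  have q: "0 < ?q" using ux h[of x] x by simp
  have "filterlim (hom c) at_top at_top" by (rule hom_at_top)
  \<comment> \<open>From here on \<open>u\<close> dominates \<open>?q * hom c\<close>, so a point
    where this product exceeds the bound \<open>M\<close> of \<open>u\<close> gives the
    contradiction.\<close>
  then obtain y where y: "x \<le> y" "(\<bar>M\<bar> + 1) / ?q \<le> hom c y"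
    unfolding filterlim_at_top eventually_at_top_linorder by (metis linear)
  have "?q * hom c y \<le> u y c"
    using mono[of x y] y(1) x pos[of y] h[of y] by (simp add: pos_le_divide_eq)
  moreover have "\<bar>M\<bar> + 1 \<le> ?q * hom c y"
    using y(2) pos_divide_le_eq[OF q, of "\<bar>M\<bar> + 1" "hom c y"] by (simp only: mult.commute)
  moreover have "\<bar>u y c\<bar> \<le> M" using M[of y c] y z x c by simp
  ultimately show False by linarith
qed

end

subsection \<open>The solution below the boundary in explicit form\<close>

context ratcheting
begin

text \<open>The factor 2 puts \<open>e0\<close> strictly inside the strip where
  \<open>vx > 1\<close> and \<open>u > 0\<close>, so it lies below every boundary point. Choosing it
  once for all \<open>c\<close> makes it usable as base point of \<open>A\<close>.\<close>

definition e0 :: real where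
  "e0 = (SOME e. 0 < e \<and> (\<forall>x c. 0 \<le> x \<longrightarrow> x \<le> 2 * e \<longrightarrow> c \<in> {0..cb} \<longrightarrow> 1 < vx x c))"

lemma e0_pos: "0 < e0" and vx_gt_1: "0 \<le> x \<Longrightarrow> x \<le> 2 * e0 \<Longrightarrow> c \<in> {0..cb} \<Longrightarrow> 1 < vx x c"
proof -
  obtain e where "0 < e" "\<And>x c. 0 \<le> x \<Longrightarrow> x \<le> e \<Longrightarrow> c \<in> {0..cb} \<Longrightarrow> 1 < vx x c"
    using vx_gt_1_near_0 by blast
  then have "\<exists>e. 0 < e \<and> (\<forall>x c. 0 \<le> x \<longrightarrow> x \<le> 2 * e \<longrightarrow> c \<in> {0..cb} \<longrightarrow> 1 < vx x c)"
    by (intro exI[of _ "e / 2"]) auto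
  from someI_ex[OF this, folded e0_def]
  show "0 < e0" and "0 \<le> x \<Longrightarrow> x \<le> 2 * e0 \<Longrightarrow> c \<in> {0..cb} \<Longrightarrow> 1 < vx x c" by auto
qed

lemma u_pos: "0 < x \<Longrightarrow> x < 2 * e0 \<Longrightarrow> c \<in> {0..cb} \<Longrightarrow> 0 < u x c"
  using u_pos_near_0[of "2 * e0"] vx_gt_1 by blast

text \<open>The coefficients are fixed by matching \<open>v\<close> and \<open>u\<close> at
  \<open>e0\<close>. That \<open>A1\<close> is the derivative of \<open>A\<close> is then a theorem,
  resting on \<open>v_c = - u\<close>.\<close>

definition A :: "real \<Rightarrow> real" where "A c = (v e0 c - Vf 0 c e0) / hom c e0"
definition A1 :: "real \<Rightarrow> real" where "A1 c = (Uf (A c) 0 c e0 - u e0 c) / hom c e0"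

lemma hom_e0: "hom c e0 > 0" using hom_pos e0_pos by simp

lemma Vf_add: "Vf a c x = Vf 0 c x + a * hom c x"
  by (simp add: Vf_def hom_def)

lemma Uf_add: "Uf a b c x = Uf a 0 c x - b * hom c x"
  by (simp add: Uf_def hom_def)

lemma Vf_A: "Vf (A c) c e0 = v e0 c"
  using hom_e0[of c] by (subst Vf_add) (simp add: A_def)

lemma Uf_A: "Uf (A c) (A1 c) c e0 = u e0 c"
  using hom_e0[of c] by (subst Uf_add) (simp add: A1_def)

lemma A_derivative:
  assumes c: "c \<in> {0..cb}"
  shows "(A has_real_derivative A1 c) (at c within {0..cb})"
proof -
  let ?h = "kap c * e0 * (th c * exp (th c * e0) - la c / exp (la c * e0))"
  have "((\<lambda>c. hom c e0) has_real_derivative ?h) (at c within {0..cb})"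
    unfolding hom_def divide_inverse mult_1_left
    apply (rule DERIV_cong)
     apply ((rule DERIV_rules exponent_c_derivatives)+)[1]
    apply (simp add: algebra_simps)
    done
  moreover have "((\<lambda>c. Vf 0 c e0) has_real_derivative - Uf 0 0 c e0) (at c within {0..cb})"
    by (rule Vf_c) simp
  ultimately have "((\<lambda>c. (v e0 c - Vf 0 c e0) / hom c e0) has_real_derivative
      ((- u e0 c - - Uf 0 0 c e0) * hom c e0 - (v e0 c - Vf 0 c e0) * ?h) / (hom c e0 * hom c e0))
      (at c within {0..cb})"
    using c e0_pos hom_e0[of c] by (intro DERIV_divide DERIV_diff v_c) auto
  moreover have "((- u e0 c - - Uf 0 0 c e0) * hom c e0 - (v e0 c - Vf 0 c e0) * ?h) / (hom c e0 * hom c e0) = A1 c"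
  proof -
    \<comment> \<open>\<open>?h\<close> is the \<open>c\<close>-derivative of
      \<open>hom c e0\<close>; this splits off the term that the quotient rule produces from the
      denominator of \<open>A\<close>.\<close>
    have "Uf (A c) 0 c e0 = Uf 0 0 c e0 - A c * ?h"
      by (simp add: Uf_def algebra_simps add_divide_distrib)
    moreover have "v e0 c - Vf 0 c e0 = A c * hom c e0" using hom_e0[of c] by (simp add: A_def)
    moreover have "((- w - - z) * H - (a * H) * h) / (H * H) = (z - a * h - w) / H" if "0 < H"
      for w z H a h :: real
      using that by (simp add: field_simps)
    ultimately show ?thesis using hom_e0[of c] by (simp only: A1_def)
  qed
  ultimately show ?thesis unfolding A_def[abs_def] by simp
qed

text \<open>Both sides solve the same linear second-order equation, and agree at the two points \<open>0\<close> and
  \<open>e0\<close>.\<close>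

lemma explicit:
  assumes c: "c \<in> {0..cb}" and b: "e0 < b" and pos: "\<And>x. 0 < x \<Longrightarrow> x < b \<Longrightarrow> 0 < u x c"
    and y: "0 \<le> y" "y < b"
  shows "v y c = Vf (A c) c y" "vx y c = Vx (A c) c y"
    "u y c = Uf (A c) (A1 c) c y" "ux y c = Ux (A c) (A1 c) c y"
proof -
  \<comment> \<open>The equations at \<open>y\<close> require a point at or beyond \<open>y\<close>
    where \<open>u\<close> is positive; the midpoint of \<open>y\<close> and \<open>b\<close> is
    one, also for \<open>y = 0\<close>.\<close>
  have mid: "0 < u ((y + b) / 2) c" if "0 \<le> y" "y < b" for y
    by (rule pos) (use that b e0_pos in auto)
  have v: "v y c = Vf (A c) c y" if y: "0 \<le> y" "y < b" for y
  proof -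
    have "v y c - Vf (A c) c y = 0"
    proof (rule homogeneous_solution_zero[where b = b and e = e0
          and h = "\<lambda>x. v x c - Vf (A c) c x" and ?h1.0 = "\<lambda>x. vx x c - Vx (A c) c x"
          and ?h2.0 = "\<lambda>x. (- (2 / \<sigma>\<^sup>2 * c) - (la c - th c) * vx x c + th c * la c * v x c) - Vxx (A c) c x"])
      fix x assume x: "0 \<le> x" "x < b"
      show "((\<lambda>x. v x c - Vf (A c) c x) has_real_derivative vx x c - Vx (A c) c x) (at x within {0..})"
        by (intro DERIV_diff v_deriv Vf_x x c)
      show "((\<lambda>x. vx x c - Vx (A c) c x) has_real_derivative
          (- (2 / \<sigma>\<^sup>2 * c) - (la c - th c) * vx x c + th c * la c * v x c) - Vxx (A c) c x) (at x within {0..})"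
        by (intro DERIV_diff v_ode[OF _ _ _ mid[OF x]] Vx_x x c) (use x in auto)
      show "(- (2 / \<sigma>\<^sup>2 * c) - (la c - th c) * vx x c + th c * la c * v x c) - Vxx (A c) c x
          + (la c - th c) * (vx x c - Vx (A c) c x) - th c * la c * (v x c - Vf (A c) c x) = 0"
        using Vf_ode[of "A c" c x] by (simp add: algebra_simps)
    qed (use b y e0_pos c v_zero Vf_A in auto)
    then show ?thesis by simp
  qed
  have vx: "vx y c = Vx (A c) c y" if y: "0 \<le> y" "y < b" for y
  proof (rule partial_x_eqI[OF _ y(1)])
    show "((\<lambda>y. v y c) has_real_derivative Vx (A c) c y) (at y within {0..})"
      by (rule has_field_derivative_transform_within[OF Vf_x, of "b - y"])
        (use y v in \<open>auto simp: dist_real_def\<close>)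
  qed
  \<comment> \<open>The forcing \<open>1 - vx\<close> agrees with \<open>1 - Vx\<close> only because
    \<open>v\<close> has been identified already; then the difference solves the homogeneous
    equation.\<close>
  have u: "u y c = Uf (A c) (A1 c) c y" if y: "0 \<le> y" "y < b" for y
  proof -
    have "u y c - Uf (A c) (A1 c) c y = 0"
    proof (rule homogeneous_solution_zero[where b = b and e = e0
          and h = "\<lambda>x. u x c - Uf (A c) (A1 c) c x" and ?h1.0 = "\<lambda>x. ux x c - Ux (A c) (A1 c) c x"
          and ?h2.0 = "\<lambda>x. (2 / \<sigma>\<^sup>2 * (1 - vx x c) - (la c - th c) * ux x c + th c * la c * u x c)
            - (2 / \<sigma>\<^sup>2 * (1 - Vx (A c) c x) - (la c - th c) * Ux (A c) (A1 c) c x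
              + th c * la c * Uf (A c) (A1 c) c x)"])
      fix x assume x: "0 \<le> x" "x < b"
      show "((\<lambda>x. u x c - Uf (A c) (A1 c) c x) has_real_derivative ux x c - Ux (A c) (A1 c) c x) (at x within {0..})"
        by (intro DERIV_diff u_deriv Uf_x x c)
      show "((\<lambda>x. ux x c - Ux (A c) (A1 c) c x) has_real_derivative
          (2 / \<sigma>\<^sup>2 * (1 - vx x c) - (la c - th c) * ux x c + th c * la c * u x c)
          - (2 / \<sigma>\<^sup>2 * (1 - Vx (A c) c x) - (la c - th c) * Ux (A c) (A1 c) c x
             + th c * la c * Uf (A c) (A1 c) c x)) (at x within {0..})"
        by (intro DERIV_diff u_ode[OF _ _ _ mid[OF x]] Ux_x x c) (use x in auto)
      show "(2 / \<sigma>\<^sup>2 * (1 - vx x c) - (la c - th c) * ux x c + th c * la c * u x c)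
          - (2 / \<sigma>\<^sup>2 * (1 - Vx (A c) c x) - (la c - th c) * Ux (A c) (A1 c) c x
             + th c * la c * Uf (A c) (A1 c) c x)
          + (la c - th c) * (ux x c - Ux (A c) (A1 c) c x) - th c * la c * (u x c - Uf (A c) (A1 c) c x) = 0"
        unfolding vx[OF x] by (simp add: algebra_simps)
    qed (use b y e0_pos c u_zero Uf_A in auto)
    then show ?thesis by simp
  qed
  have ux: "ux y c = Ux (A c) (A1 c) c y" if y: "0 \<le> y" "y < b" for y
  proof (rule partial_x_eqI[OF _ y(1)])
    show "((\<lambda>y. u y c) has_real_derivative Ux (A c) (A1 c) c y) (at y within {0..})"
      by (rule has_field_derivative_transform_within[OF Uf_x, of "b - y"])
        (use y u in \<open>auto simp: dist_real_def\<close>)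
  qed
  show "v y c = Vf (A c) c y" "vx y c = Vx (A c) c y"
    "u y c = Uf (A c) (A1 c) c y" "ux y c = Ux (A c) (A1 c) c y"
    using v vx u ux y by auto
qed

text \<open>Otherwise the explicit form holds on the whole half line, and boundedness of
  \<open>v\<close> and \<open>u\<close> forces \<open>A c = 0\<close> and then
  \<open>A1 c = 0\<close>. What remains of \<open>r * u\<close> tends to -1.\<close>

lemma u_has_zero:
  assumes c: "c \<in> {0..cb}"
  obtains y where "0 < y" "u y c = 0"
proof -
  have "\<exists>y>0. u y c = 0"
  proof (rule ccontr)
    assume "\<not> ?thesis"
    then have pos: "0 < u x c" if "0 < x" for x using u_nonneg[of x c] that c by (auto simp: less_le)
    have ex: "v y c = Vf (A c) c y" "u y c = Uf (A c) (A1 c) c y" if "0 \<le> y" for y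
      using explicit[OF c, of "y + e0 + 1" y] pos that e0_pos by auto
    have p: "0 < 1 / exp (la c * y)" "1 / exp (la c * y) \<le> 1" if "0 \<le> y" for y
      using la_pos[of c] that by auto
    have "A c = 0"
    proof (rule hom_multiple_bounded)
      fix y :: real assume y: "0 \<le> y"
      have "A c * hom c y = v y c - c / r * (1 - 1 / exp (la c * y))"
        using ex(1)[OF y] by (simp add: Vf_def hom_def)
      moreover have "0 \<le> c / r" using c r_pos by simp
      then have "0 \<le> c / r * (1 - 1 / exp (la c * y))"
        using p[OF y] by (intro mult_nonneg_nonneg) auto
      moreover have "c / r * (1 - 1 / exp (la c * y)) \<le> c / r"
        using p[OF y] \<open>0 \<le> c / r\<close> by (intro mult_left_le) auto
      ultimately show "\<bar>A c * hom c y\<bar> \<le> cb / r + c / r"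
        using v_bounds[OF y c] by (auto simp: abs_le_iff)
    qed
    have E: "(1 + la c * y + (la c * y)\<^sup>2 / 2) \<le> exp (la c * y)" if "0 \<le> y" for y
      using exp_lower_Taylor_quadratic[of "la c * y"] la_pos[of c] that by simp
    obtain M where M: "\<And>x c. 0 \<le> x \<Longrightarrow> c \<in> {0..cb} \<Longrightarrow> \<bar>u x c\<bar> \<le> M"
      using continuous_bounded_bound[OF u_regular(1)] by blast
    have "A1 c = 0"
    proof (rule hom_multiple_bounded)
      fix y :: real assume y: "0 \<le> y"
      have eq: "A1 c * hom c y = kap c * (c / r) * (la c * y / exp (la c * y)) - (1 - 1 / exp (la c * y)) / r - u y c"
        using ex(2)[OF y] \<open>A c = 0\<close> by (simp add: Uf_def hom_def diff_divide_distrib)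
      have "la c * y / exp (la c * y) \<le> 1" "0 \<le> la c * y / exp (la c * y)"
        using E[OF y] la_pos[of c] y by (auto simp: divide_le_eq intro: order_trans[OF _ E[OF y]])
      then have "0 \<le> kap c * (c / r) * (la c * y / exp (la c * y))"
        "kap c * (c / r) * (la c * y / exp (la c * y)) \<le> kap c * (c / r) * 1"
        using kap_pos[of c] c r_pos by (intro mult_nonneg_nonneg mult_left_mono; simp)+
      moreover have "0 \<le> (1 - 1 / exp (la c * y)) / r" "(1 - 1 / exp (la c * y)) / r \<le> 1 / r"
        using p[OF y] r_pos by (auto intro!: divide_nonneg_pos divide_right_mono)
      ultimately show "\<bar>A1 c * hom c y\<bar> \<le> kap c * (c / r) + 1 / r + M"
        using M[OF y c] unfolding eq by (simp add: abs_le_iff)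
    qed
    \<comment> \<open>Chosen so that \<open>la c * y > 2 * kap c * c\<close>: the quadratic Taylor
      term of the exponential then beats the linear numerator. The \<open>+ 1\<close> also keeps
      \<open>y\<close> positive for \<open>c = 0\<close>.\<close>
    define y where "y = 2 * kap c * c / la c + 1"
    have y: "0 < y" using kap_pos[of c] la_pos[of c] c by (simp add: y_def add_nonneg_pos)
    have "2 * kap c * c < la c * y" using la_pos[of c] by (simp add: y_def algebra_simps)
    then have "kap c * c * (la c * y) < (la c * y) / 2 * (la c * y)"
      using la_pos[of c] y by (intro mult_strict_right_mono) auto
    moreover have "0 < la c * y" using la_pos[of c] y by simp
    ultimately have "1 + kap c * c * (la c * y) < exp (la c * y)"
      using E[of y] y by (simp add: power2_eq_square)
    then have "(1 + kap c * c * (la c * y)) / exp (la c * y) < 1" by simp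
    moreover have "r * u y c = (1 + kap c * c * (la c * y)) / exp (la c * y) - 1"
      using ex(2)[of y] y \<open>A c = 0\<close> \<open>A1 c = 0\<close> r_pos by (simp add: Uf_def field_simps)
    ultimately have "r * u y c < 0" by simp
    then show False using pos[OF y] r_pos by (simp add: mult_less_0_iff)
  qed
  with that show thesis by blast
qed

abbreviation X :: "real \<Rightarrow> real" where "X \<equiv> free_boundary cb v"

text \<open>Zeros stay away from 0 by \<open>u_pos\<close>, so continuity gives a least one;
  \<open>u_zero_persists\<close> extends it to a half line. The infimum is therefore a
  minimum.\<close>

lemma boundary:
  assumes c: "c \<in> {0..cb}"
  shows boundary_gt: "e0 < X c" and u_boundary: "u (X c) c = 0"
    and u_pos_below: "\<And>x. 0 < x \<Longrightarrow> x < X c \<Longrightarrow> 0 < u x c"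
    and u_zero_above: "\<And>x. X c \<le> x \<Longrightarrow> u x c = 0"
proof -
  obtain y where y: "0 < y" "u y c = 0" by (rule u_has_zero[OF c])
  have "\<not> y < 2 * e0" using u_pos[of y c] y c by auto
  then have ey: "e0 \<le> y" using e0_pos by simp
  have "continuous_on {e0..y} (\<lambda>y. u y c)"
    using e0_pos c by (intro u_continuous continuous_intros) auto
  then obtain z where z: "z \<in> {e0..y}" "u z c = 0" "\<And>x. e0 \<le> x \<Longrightarrow> x < z \<Longrightarrow> 0 < u x c"
    by (rule first_zero[where f="\<lambda>y. u y c"]) (use y ey e0_pos c u_nonneg in auto)
  have pos: "0 < u x c" if "0 < x" "x < z" for x
    using u_pos[of x c] z(3)[of x] that e0_pos c by (cases "x < e0") auto
  have "{x. x > 0 \<and> partial_c cb v x c = 0} = {x. x > 0 \<and> u x c = 0}"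
    using partial_c_v[OF _ c] by auto
  then have X: "X c = Inf {x. x > 0 \<and> u x c = 0}" by (simp add: free_boundary_def)
  have Xz: "X c = z"
    unfolding X
  proof (rule cInf_eq_minimum)
    show "z \<in> {x. 0 < x \<and> u x c = 0}" using z e0_pos by auto
    show "z \<le> x" if "x \<in> {x. 0 < x \<and> u x c = 0}" for x
      using pos[of x] that by force
  qed
  have "z \<noteq> e0" using u_pos[of e0 c] z(2) e0_pos c by auto
  then show gt: "e0 < X c" using z Xz by auto
  show "u (X c) c = 0" using z Xz by simp
  show "\<And>x. 0 < x \<Longrightarrow> x < X c \<Longrightarrow> 0 < u x c" using pos Xz by simp
  show "\<And>x. X c \<le> x \<Longrightarrow> u x c = 0"
    using u_zero_persists[of z c] z(2) gt e0_pos Xz c by simp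
qed

text \<open>Continuity extends \<open>explicit\<close> to the closed interval, so that smooth fit
  becomes a condition on the explicit functions.\<close>

lemma explicit_boundary:
  assumes c: "c \<in> {0..cb}" and y: "0 \<le> y" "y \<le> X c"
  shows "vx y c = Vx (A c) c y" "u y c = Uf (A c) (A1 c) c y" "ux y c = Ux (A c) (A1 c) c y"
proof -
  have X: "0 < X c" using boundary_gt[OF c] e0_pos by simp
  have cl: "closure {0..<X c} = {0..X c}" using X by simp
  have eq: "f y = g y" if "continuous_on {0..X c} f" "continuous_on {0..X c} g" "\<And>y. 0 \<le> y \<Longrightarrow> y < X c \<Longrightarrow> f y = g y"
    for f g :: "real \<Rightarrow> real"
  proof -
    have "f y - g y = 0"
      by (rule continuous_constant_on_closure[where S="{0..<X c}" and f="\<lambda>y. f y - g y"])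
        (use that cl y in \<open>auto intro!: continuous_intros\<close>)
    then show ?thesis by simp
  qed
  note ex = explicit[OF c boundary_gt[OF c] u_pos_below[OF c]]
  have cont: "continuous_on {0..X c} (Vx (A c) c)" "continuous_on {0..X c} (Uf (A c) (A1 c) c)"
    "continuous_on {0..X c} (Ux (A c) (A1 c) c)"
    by (rule DERIV_continuous_on[OF Vx_x] DERIV_continuous_on[OF Uf_x] DERIV_continuous_on[OF Ux_x])+
  show "vx y c = Vx (A c) c y"
    by (rule eq[of "\<lambda>y. vx y c"]) (use c cont ex in \<open>auto intro!: vx_continuous continuous_intros\<close>)
  show "u y c = Uf (A c) (A1 c) c y"
    by (rule eq[of "\<lambda>y. u y c"]) (use c cont ex in \<open>auto intro!: u_continuous continuous_intros\<close>)
  show "ux y c = Ux (A c) (A1 c) c y"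
    by (rule eq[of "\<lambda>y. ux y c"]) (use c cont ex in \<open>auto intro!: ux_continuous continuous_intros\<close>)
qed

text \<open>Smooth fit: \<open>X c\<close> is an interior minimum point of the nonnegative
  differentiable function \<open>u\<close>.\<close>

lemma ux_boundary:
  assumes c: "c \<in> {0..cb}"
  shows "ux (X c) c = 0"
proof (rule zero_of_nonneg_derivatives(1)[where f="\<lambda>y. u y c" and f'="\<lambda>y. ux y c"])
  show "((\<lambda>y. u y c) has_real_derivative ux y c) (at y)" if "0 < y" for y
    using u_deriv[of y c] that c by (simp add: at_within_nonneg_eq)
qed (use c boundary_gt[OF c] e0_pos u_boundary[OF c] u_nonneg in auto)

end

subsection \<open>Nondegeneracy at the free boundary\<close>

context characteristic
begin

text \<open>Both sides vanish at 0 and have equal derivatives. The parameter \<open>b\<close>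
  disappears because it enters \<open>Uf\<close> only through a multiple of \<open>hom\<close>,
  whose own Wronskian is 0.\<close>

lemma wronskian_Jf: "psi c x * Ux a b c x - chi c x * Uf a b c x = 2 / \<sigma>\<^sup>2 * Jf a c x"
proof -
  let ?D = "\<lambda>x. (psi c x * Ux a b c x - chi c x * Uf a b c x) - 2 / \<sigma>\<^sup>2 * Jf a c x"
  have "(?D has_real_derivative 0) (at x)" for x
    by (rule DERIV_cong[OF DERIV_diff[OF wronskian_derivative[OF Uf_x Ux_x] DERIV_cmult[OF Jf_x]]])
      (simp add: algebra_simps diff_divide_distrib)
  then have "?D x = ?D 0" by (intro DERIV_isconst_all) auto
  then show ?thesis by simp
qed

lemma Jf_mvt:
  obtains z where "min x y \<le> z" "z \<le> max x y" "x \<noteq> y \<Longrightarrow> min x y < z \<and> z < max x y"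
    "Jf a c y - Jf a c x = (y - x) * (psi c z * (1 - Vx a c z))"
proof -
  have *: "\<exists>z. p \<le> z \<and> z \<le> q \<and> (p \<noteq> q \<longrightarrow> p < z \<and> z < q) \<and> Jf a c q - Jf a c p = (q - p) * (psi c z * (1 - Vx a c z))"
    if "p \<le> q" for p q
  proof (cases "p = q")
    case False
    then have "\<exists>z>p. z < q \<and> Jf a c q - Jf a c p = (q - p) * (psi c z * (1 - Vx a c z))"
      using that by (intro MVT2 Jf_x) auto
    then show ?thesis by (meson less_imp_le)
  qed auto
  show thesis
  proof (cases "x \<le> y")
    case True
    then show thesis using *[OF True] that by (auto simp: min_def max_def)
  next
    case False
    then obtain z where "y < z" "z < x" "Jf a c x - Jf a c y = (x - y) * (psi c z * (1 - Vx a c z))"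
      using *[of y x] by auto
    then show thesis using that[of z] False by (auto simp: min_def max_def algebra_simps)
  qed
qed

end

lemma continuous_positive_nhd:
  fixes g :: "real \<Rightarrow> real \<Rightarrow> real"
  assumes g: "continuous_on (UNIV \<times> S) (\<lambda>(x, c). g x c)" and "c \<in> S" "0 < g x c"
  obtains d where "0 < d" "\<And>x' c'. \<bar>x' - x\<bar> < d \<Longrightarrow> c' \<in> S \<Longrightarrow> \<bar>c' - c\<bar> < d \<Longrightarrow> 0 < g x' c'"
proof -
  have "(x, c) \<in> UNIV \<times> S" using assms(2) by simp
  with g obtain d where d: "0 < d"
    "\<And>p. p \<in> UNIV \<times> S \<Longrightarrow> dist p (x, c) < d \<Longrightarrow> dist (case p of (x, c) \<Rightarrow> g x c) (g x c) < g x c"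
    unfolding continuous_on_iff using assms(3) by fastforce
  show thesis
  proof (rule that[of "d / 2"])
    fix x' c' assume h: "\<bar>x' - x\<bar> < d / 2" "c' \<in> S" "\<bar>c' - c\<bar> < d / 2"
    have "dist (x', c') (x, c) \<le> \<bar>x' - x\<bar> + \<bar>c' - c\<bar>"
      unfolding dist_Pair_Pair dist_real_def using sqrt_sum_squares_le_sum_abs by simp
    then show "0 < g x' c'" using d(2)[of "(x', c')"] h by (auto simp: dist_real_def)
  qed (use d in simp)
qed

context ratcheting
begin

lemma A_continuous: "continuous_on {0..cb} A"
  by (rule DERIV_continuous_on[OF A_derivative])

lemma continuous_on_snd_compose:
  assumes "continuous_on {0..cb} f"
  shows "continuous_on (T \<times> {0..cb}) (\<lambda>p. f (snd p))"
  by (rule continuous_on_compose2[OF assms continuous_on_snd[OF continuous_on_id]]) auto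

lemmas joint_intros = continuous_on_snd_compose[OF A_continuous]
  continuous_on_snd_compose[OF continuous_on_th] continuous_on_snd_compose[OF continuous_on_la]

lemma joint_continuous:
  "continuous_on (UNIV \<times> {0..cb}) (\<lambda>(x, c). Vx (A c) c x)"
  "continuous_on (UNIV \<times> {0..cb}) (\<lambda>(x, c). Vxx (A c) c x)"
  "continuous_on (UNIV \<times> {0..cb}) (\<lambda>(x, c). psi c x * (1 - Vx (A c) c x))"
  unfolding split_beta Vx_def Vxx_def psi_def using r_pos
  by (intro continuous_intros joint_intros; simp)+

lemma Jf_boundary:
  assumes c: "c \<in> {0..cb}"
  shows "Jf (A c) c (X c) = 0"
proof -
  have "0 \<le> X c" using boundary_gt[OF c] e0_pos by simp
  then have "Uf (A c) (A1 c) c (X c) = 0" "Ux (A c) (A1 c) c (X c) = 0"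
    using explicit_boundary[OF c, of "X c"] u_boundary[OF c] ux_boundary[OF c] by auto
  with wronskian_Jf[of c "X c" "A c" "A1 c"] show ?thesis using \<sigma>_pos by simp
qed

lemma Vx_gt_1: "c \<in> {0..cb} \<Longrightarrow> 0 \<le> x \<Longrightarrow> x \<le> e0 \<Longrightarrow> 1 < Vx (A c) c x"
  using explicit_boundary(1)[of c x] boundary_gt[of c] vx_gt_1[of x c] e0_pos by simp

lemma Vx_le_1:
  "c \<in> {0..cb} \<Longrightarrow> 0 \<le> x \<Longrightarrow> x \<le> y \<Longrightarrow> y \<le> X c \<Longrightarrow> Vx (A c) c x \<le> 1 \<Longrightarrow> Vx (A c) c y \<le> 1"
  using explicit_boundary(1)[of c x] explicit_boundary(1)[of c y] vx_le_1[of x y c] by simp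

text \<open>\<open>Jf\<close> starts at 0, is negative at \<open>e0\<close> because
  \<open>Vx > 1\<close> up to there, and returns to 0 at \<open>X c\<close>. It must increase
  somewhere in between.\<close>

lemma Vx_lt_1_below:
  assumes c: "c \<in> {0..cb}"
  obtains z where "e0 < z" "z < X c" "Vx (A c) c z < 1"
proof -
  note X = boundary_gt[OF c]
  obtain w where w: "0 < w" "w < e0" "Jf (A c) c e0 = e0 * (psi c w * (1 - Vx (A c) c w))"
    using Jf_mvt[of 0 e0 "A c" c] e0_pos by auto
  have "Jf (A c) c e0 < 0"
    using w Vx_gt_1[OF c, of w] e0_pos psi_pos[of w c] by (simp add: mult_less_0_iff)
  moreover obtain z where z: "e0 < z" "z < X c"
      "Jf (A c) c (X c) - Jf (A c) c e0 = (X c - e0) * (psi c z * (1 - Vx (A c) c z))"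
    using Jf_mvt[of e0 "X c" "A c" c] X by auto
  ultimately have "0 < (X c - e0) * (psi c z * (1 - Vx (A c) c z))"
    using Jf_boundary[OF c] by simp
  then have "Vx (A c) c z < 1"
    using X psi_pos[of z c] z e0_pos by (simp add: zero_less_mult_iff)
  with z that show thesis by blast
qed

text \<open>By \<open>Vx_le_1\<close>, once \<open>Vx\<close> is below 1 it never exceeds 1 again,
  so \<open>Jf\<close> first decreases and then increases. It is 0 at both ends.\<close>

lemma Jf_nonpos:
  assumes c: "c \<in> {0..cb}" and x: "0 \<le> x" "x \<le> X c"
  shows "Jf (A c) c x \<le> 0"
proof (cases "\<exists>y. 0 \<le> y \<and> y \<le> x \<and> Vx (A c) c y < 1")
  case True
  obtain z where z: "x \<le> z" "z \<le> X c" "Jf (A c) c (X c) - Jf (A c) c x = (X c - x) * (psi c z * (1 - Vx (A c) c z))"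
    using Jf_mvt[of x "X c" "A c" c] x by auto
  have "Vx (A c) c z \<le> 1" using True Vx_le_1[OF c, of _ z] z by (meson less_imp_le order_trans)
  moreover have "0 \<le> psi c z" using psi_pos[of z c] z x by (cases "z = 0") auto
  ultimately have "0 \<le> (X c - x) * (psi c z * (1 - Vx (A c) c z))" using x by simp
  with z show ?thesis using Jf_boundary[OF c] by simp
next
  case False
  obtain z where z: "0 \<le> z" "z \<le> x" "Jf (A c) c x = x * (psi c z * (1 - Vx (A c) c z))"
    using Jf_mvt[of 0 x "A c" c] x by auto
  have "1 \<le> Vx (A c) c z" using False z by force
  moreover have "0 \<le> psi c z" using psi_pos[of z c] z x by (cases "z = 0") auto
  ultimately show ?thesis using z x by (simp add: mult_nonneg_nonpos)
qed

text \<open>\<open>psi\<close> solves the adjoint equation, so the \<open>c\<close>-derivative of that equation turns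
  \<open>Jc\<close> at the boundary into \<open>-2\<close> times the integral of \<open>psi' * u\<close>.\<close>

lemma Jc_boundary_neg:
  assumes c: "c \<in> {0..cb}"
  shows "Jc (A c) (A1 c) c (X c) < 0"
proof -
  let ?U = "Uf (A c) (A1 c) c" and ?Ux = "Ux (A c) (A1 c) c" and ?J = "Jc (A c) (A1 c) c"
  \<comment> \<open>The terms besides \<open>?J\<close> are the boundary terms of the integration by
    parts: they vanish at 0 and at \<open>X c\<close>, and they leave only the product of
    \<open>?p\<close>, the derivative of \<open>psi\<close>, with \<open>?U\<close> in the
    derivative.\<close>
  let ?T = "\<lambda>x. 2 / \<sigma>\<^sup>2 * ?J x - (psic c x * ?Ux x - psicx c x * ?U x)
      - (la c - th c) * (psic c x * ?U x) - 2 / \<sigma>\<^sup>2 * (psi c x * ?U x)"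
  let ?p = "\<lambda>x. la c * exp (la c * x) + th c / exp (th c * x)"
  have T: "(?T has_real_derivative - (4 / \<sigma>\<^sup>2 * ?p x * ?U x)) (at x)" for x
    apply (rule DERIV_cong)
     apply (rule DERIV_diff DERIV_cmult DERIV_mult Jc_x psic_x psicx_x psi_x Uf_x Ux_x)+
    apply (simp add: algebra_simps)
    done
  have X: "0 < X c" using boundary_gt[OF c] e0_pos by simp
  then have "\<exists>z>0. z < X c \<and> ?T (X c) - ?T 0 = (X c - 0) * (- (4 / \<sigma>\<^sup>2 * ?p z * ?U z))"
    by (intro MVT2 T) auto
  then obtain z where z: "0 < z" "z < X c" "?T (X c) - ?T 0 = (X c - 0) * (- (4 / \<sigma>\<^sup>2 * ?p z * ?U z))"
    by blast
  have "0 < ?U z" using explicit_boundary(2)[OF c, of z] u_pos_below[OF c, of z] z by simp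
  moreover have "0 < ?p z" using la_pos[of c] th_pos[of c] by (simp add: add_pos_pos)
  ultimately have "?T (X c) - ?T 0 < 0"
    unfolding z(3) using X \<sigma>_pos by (simp add: mult_less_0_iff zero_less_mult_iff)
  moreover have p0: "psic c 0 = 0" by (simp add: psic_def)
  moreover have "?T 0 = 0" by (simp add: p0)
  moreover have "?U (X c) = 0" "?Ux (X c) = 0"
    using explicit_boundary[OF c, of "X c"] u_boundary[OF c] ux_boundary[OF c] X by auto
  ultimately have "2 / \<sigma>\<^sup>2 * ?J (X c) < 0" by (simp only: mult_zero_right mult_zero_left diff_zero diff_0_right)
  then show ?thesis using \<sigma>_pos by (simp add: divide_less_0_iff mult_less_0_iff)
qed

text \<open>The parameters for which \<open>u\<close> has a zero in \<open>[e0, x]\<close> form the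
  projection of a compact set; it is closed and misses \<open>c\<close>.\<close>

lemma boundary_lower_semicontinuous:
  assumes c: "c \<in> {0..cb}" and x: "x < X c"
  shows "\<forall>\<^sub>F c' in at c within {0..cb}. x < X c'"
proof -
  let ?Q = "{e0..x} \<times> {0..cb}"
  let ?Z = "?Q \<inter> (\<lambda>p. u (fst p) (snd p)) -` {0}"
  have "continuous_on ?Q (\<lambda>p. u (fst p) (snd p))"
    using e0_pos by (intro u_continuous continuous_intros) auto
  then have "closed ?Z" by (rule continuous_closed_preimage) (auto intro: closed_Times)
  then have "compact (?Q \<inter> ?Z)" by (intro compact_Int_closed compact_Times) auto
  then have "compact (snd ` ?Z)"
    by (intro compact_continuous_image continuous_intros) (simp add: Int_assoc[symmetric])
  then have "open (- snd ` ?Z)" by (simp add: compact_imp_closed open_closed)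
  moreover have "c \<notin> snd ` ?Z"
  proof
    assume "c \<in> snd ` ?Z"
    then obtain y where "e0 \<le> y" "y \<le> x" "u y c = 0" by auto
    then show False using u_pos_below[OF c, of y] x e0_pos by simp
  qed
  ultimately have "\<forall>\<^sub>F c' in at c within {0..cb}. c' \<in> - snd ` ?Z"
    by (intro eventually_at_topological[THEN iffD2]) blast
  moreover have "\<forall>\<^sub>F c' in at c within {0..cb}. c' \<in> {0..cb}"
    by (simp add: eventually_at_filter)
  ultimately show ?thesis
  proof eventually_elim
    case (elim c')
    have "\<not> X c' \<le> x"
    proof
      assume "X c' \<le> x"
      then have "(X c', c') \<in> ?Z" using elim(2) boundary_gt[of c'] u_boundary[of c'] by auto
      then show False using elim(1) by force
    qed
    then show ?case by simp
  qed
qed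


section \<open>Excluding \<open>vx = 1\<close> at the boundary\<close>

lemma A_top: "A cb = 0"
  using v_top[of e0] e0_pos by (simp add: A_def gfun_eq)

lemma eventually_in_interval: "\<forall>\<^sub>F c' in at c within {0..cb}. c' \<in> {0..cb}"
  by (simp add: eventually_at_filter)

lemma eventually_near:
  assumes "0 < d"
  shows "\<forall>\<^sub>F c' in at c within {0..cb}. \<bar>c' - c\<bar> < d"
  using assms unfolding eventually_at by (intro exI[of _ d]) (auto simp: dist_real_def)

lemma eventually_Vx_gt:
  assumes "c \<in> {0..cb}" "a < Vx (A c) c x"
  shows "\<forall>\<^sub>F c' in at c within {0..cb}. a < Vx (A c') c' x"
proof -
  have "continuous (at c within {0..cb}) (\<lambda>c. Vx (A c) c x)"
    by (rule DERIV_continuous[OF Vx_c[OF A_derivative[OF assms(1)]]])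
  then show ?thesis using assms(2) by (auto simp: continuous_within order_tendsto_iff)
qed

lemma eventually_Vx_lt:
  assumes "c \<in> {0..cb}" "Vx (A c) c x < a"
  shows "\<forall>\<^sub>F c' in at c within {0..cb}. Vx (A c') c' x < a"
proof -
  have "continuous (at c within {0..cb}) (\<lambda>c. Vx (A c) c x)"
    by (rule DERIV_continuous[OF Vx_c[OF A_derivative[OF assms(1)]]])
  then show ?thesis using assms(2) by (auto simp: continuous_within order_tendsto_iff)
qed

lemma eventually_Jf_pos:
  assumes "c \<in> {0..cb}" "0 < Jf (A c) c x"
  shows "\<forall>\<^sub>F c' in at c within {0..cb}. 0 < Jf (A c') c' x"
proof -
  have "continuous (at c within {0..cb}) (\<lambda>c. Jf (A c) c x)"
    by (rule DERIV_continuous[OF Jf_c[OF A_derivative[OF assms(1)]]])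
  then show ?thesis using assms(2) by (auto simp: continuous_within order_tendsto_iff)
qed

text \<open>Otherwise \<open>Vx > 1\<close> just left of \<open>X c\<close>, although it was below 1
  before. If \<open>Vxx\<close> is 0 there, its own derivative is \<open>th c * la c > 0\<close>, so
  \<open>Vxx\<close> is negative slightly to the left.\<close>

lemma Vxx_pos_of_Vx_eq_1:
  assumes c: "c \<in> {0..cb}" and eq: "Vx (A c) c (X c) = 1"
  shows "0 < Vxx (A c) c (X c)"
proof (rule ccontr)
  assume neg: "\<not> 0 < Vxx (A c) c (X c)"
  obtain z where z: "e0 < z" "z < X c" "Vx (A c) c z < 1" by (rule Vx_lt_1_below[OF c])
  have "\<exists>d>0. \<forall>h>0. h < d \<longrightarrow> Vx (A c) c (X c) < Vx (A c) c (X c - h)"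
  proof (cases "Vxx (A c) c (X c) < 0")
    case True
    then show ?thesis by (rule DERIV_neg_dec_left[OF Vx_x])
  next
    case False
    then have 0: "Vxx (A c) c (X c) = 0" using neg by simp
    have "(Vxx (A c) c has_real_derivative th c * la c) (at (X c))"
      using Vxx_x[of "A c" c "X c" UNIV] 0 eq by simp
    moreover have "0 < th c * la c" using th_pos la_pos by simp
    ultimately obtain d where d: "0 < d" "\<And>h. 0 < h \<Longrightarrow> h < d \<Longrightarrow> Vxx (A c) c (X c - h) < 0"
      using DERIV_pos_inc_left 0 by metis
    show ?thesis
    proof (intro exI[of _ d] conjI allI impI d(1))
      fix h :: real assume h: "0 < h" "h < d"
      then have "\<exists>w>X c - h. w < X c \<and> Vx (A c) c (X c) - Vx (A c) c (X c - h) = (X c - (X c - h)) * Vxx (A c) c w"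
        by (intro MVT2 Vx_x) auto
      then obtain w where w: "X c - h < w" "w < X c" "Vx (A c) c (X c) - Vx (A c) c (X c - h) = h * Vxx (A c) c w"
        by auto
      then have "Vxx (A c) c w < 0" using d(2)[of "X c - w"] h by simp
      then have "h * Vxx (A c) c w < 0" using h by (simp add: mult_pos_neg)
      then show "Vx (A c) c (X c) < Vx (A c) c (X c - h)" using w(3) by simp
    qed
  qed
  then obtain d where d: "0 < d" "\<And>h. 0 < h \<Longrightarrow> h < d \<Longrightarrow> 1 < Vx (A c) c (X c - h)"
    using eq by auto
  define h where "h = min (d / 2) (X c - z)"
  have h: "0 < h" "h < d" "z \<le> X c - h" using d z by (auto simp: h_def)
  have "Vx (A c) c (X c - h) \<le> 1"
    by (rule Vx_le_1[OF c _ h(3)]) (use z h e0_pos in auto)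
  with d(2)[OF h(1,2)] show False by simp
qed

text \<open>If \<open>v\<^sub>x = 1\<close> at the boundary, then \<open>v\<^sub>x\<close> is increasing there. For \<open>c'\<close> slightly above \<open>c\<close>
  this forces the value of \<open>Jf\<close> at the old boundary point to be at least \<open>-o(c' - c)\<close>, whereas its
  \<open>c\<close>-derivative is negative.\<close>

lemma Vx_boundary_lt_1:
  assumes c: "c \<in> {0..cb}"
  shows "Vx (A c) c (X c) < 1"
proof (rule ccontr)
  assume ge: "\<not> Vx (A c) c (X c) < 1"
  obtain \<xi> where \<xi>: "e0 < \<xi>" "\<xi> < X c" "Vx (A c) c \<xi> < 1" by (rule Vx_lt_1_below[OF c])
  have "Vx (A c) c (X c) \<le> 1" by (rule Vx_le_1[OF c, of \<xi>]) (use \<xi> e0_pos in auto)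
  with ge have eq: "Vx (A c) c (X c) = 1" by simp
  note pos = Vxx_pos_of_Vx_eq_1[OF c eq]
  \<comment> \<open>At \<open>cb\<close> the coefficient \<open>A\<close> is 0 and
    \<open>v = g\<close> is concave. This leaves room to the right of \<open>c\<close>, where the
    difference quotients are taken.\<close>
  have "c \<noteq> cb"
  proof
    assume "c = cb"
    then have "Vxx (A c) c (X c) = - (cb / r * (la cb)\<^sup>2 / exp (la cb * X cb))"
      by (simp add: Vxx_def A_top)
    moreover have "0 \<le> cb / r * (la cb)\<^sup>2 / exp (la cb * X cb)" using cb_nonneg r_pos by simp
    ultimately show False using pos by simp
  qed
  then have "c < cb" using c by simp
  let ?F = "at c within {c<..cb}"
  have sub: "{c<..cb} \<subseteq> {0..cb}" using c by auto
  have F: "?F \<noteq> bot"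
    unfolding trivial_limit_within
    using islimpt_subset[OF islimpt_greaterThanLessThan1[OF \<open>c < cb\<close>], of "{c<..cb}"] by force
  obtain d where d: "0 < d" "\<And>x c'. \<bar>x - X c\<bar> < d \<Longrightarrow> c' \<in> {0..cb} \<Longrightarrow> \<bar>c' - c\<bar> < d \<Longrightarrow> 0 < Vxx (A c') c' x"
    using continuous_positive_nhd[OF joint_continuous(2) c pos] by blast
  define \<eta> where "\<eta> = min (d / 2) ((X c - \<xi>) / 2)"
  have \<eta>: "0 < \<eta>" "\<eta> < d"
    using d(1) \<xi>(2) by (simp_all add: \<eta>_def min_less_iff_disj)
  have "\<eta> < X c - \<xi>"
    unfolding \<eta>_def by (rule le_less_trans[OF min.cobounded2]) (use \<xi>(2) in simp)
  then have \<eta>: "0 < \<eta>" "\<eta> < d" "\<xi> < X c - \<eta>" using \<eta> by simp_all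
  have incr: "Vx (A c') c' x < Vx (A c') c' y"
    if "X c - \<eta> \<le> x" "x < y" "y \<le> X c + \<eta>" "c' \<in> {0..cb}" "\<bar>c' - c\<bar> < d" for x y c'
  proof (rule DERIV_pos_imp_increasing[OF that(2)])
    fix t assume "x \<le> t" "t \<le> y"
    then show "\<exists>k. (Vx (A c') c' has_real_derivative k) (at t) \<and> 0 < k"
      using d(2)[of t c'] that \<eta> Vx_x[of "A c'" c' t UNIV] by (intro exI[of _ "Vxx (A c') c' t"]) auto
  qed
  \<comment> \<open>Bounds \<open>psi c' z * \<bar>X c - X c'\<bar>\<close> for nearby
    \<open>c'\<close>; only its independence of \<open>c'\<close> matters.\<close>
  define C where "C = exp ((la c + 1) * (X c + \<eta>)) * \<eta>"
  have "\<forall>\<^sub>F c' in at c within {0..cb}. la c' < la c + 1"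
  proof -
    have "continuous (at c within {0..cb}) la" by (rule DERIV_continuous[OF la_derivative])
    then show ?thesis by (auto simp: continuous_within order_tendsto_iff)
  qed
  moreover have "\<forall>\<^sub>F c' in at c within {0..cb}. X c - \<eta> < X c'"
    by (rule boundary_lower_semicontinuous[OF c]) (use \<eta> in simp)
  moreover have "\<forall>\<^sub>F c' in at c within {0..cb}. 1 < Vx (A c') c' (X c + \<eta>)"
    using incr[of "X c" "X c + \<eta>" c] \<eta> d(1) c eq by (intro eventually_Vx_gt c) auto
  ultimately have main: "\<forall>\<^sub>F c' in at c within {0..cb}. - (C * \<bar>Vx (A c') c' (X c) - 1\<bar>) \<le> Jf (A c') c' (X c)"
    using eventually_in_interval[of c] eventually_near[OF d(1), of c] eventually_Vx_lt[OF c \<xi>(3)]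
  proof eventually_elim
    case (elim c')
    note c' = elim(4)
    \<comment> \<open>Continuity of \<open>X\<close> is not known yet. Below \<open>X c'\<close> the
      function \<open>Vx\<close> cannot exceed 1 after being below 1 at \<open>\<xi>\<close>, but it
      does exceed 1 at \<open>X c + \<eta>\<close>.\<close>
    have X': "X c' < X c + \<eta>"
    proof (rule ccontr)
      assume "\<not> ?thesis"
      then have "Vx (A c') c' (X c + \<eta>) \<le> 1"
        using Vx_le_1[OF c', of \<xi> "X c + \<eta>"] elim(6) \<xi>(1,2) \<eta>(1) e0_pos by simp
      with elim(3) show False by simp
    qed
    obtain z where z: "min (X c') (X c) \<le> z" "z \<le> max (X c') (X c)"
        "Jf (A c') c' (X c) - Jf (A c') c' (X c') = (X c - X c') * (psi c' z * (1 - Vx (A c') c' z))"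
      using Jf_mvt[of "X c'" "X c" "A c'" c'] by metis
    have "0 < min (X c') (X c)" "max (X c') (X c) \<le> X c + \<eta>"
      using boundary_gt[OF c'] boundary_gt[OF c] e0_pos X' \<eta>(1) by simp_all
    then have z0: "0 < z" "z \<le> X c + \<eta>"
      using less_le_trans[OF _ z(1)] order_trans[OF z(2)] by auto
    have psi: "0 \<le> psi c' z" "psi c' z \<le> exp ((la c + 1) * (X c + \<eta>))"
    proof -
      show "0 \<le> psi c' z" using psi_pos[OF z0(1), of c'] by simp
      have "psi c' z \<le> exp (la c' * z)" by (simp add: psi_def)
      also have "la c' * z \<le> (la c + 1) * (X c + \<eta>)"
        using elim(1) z0 la_pos[of c'] by (intro mult_mono) auto
      finally show "psi c' z \<le> exp ((la c + 1) * (X c + \<eta>))" by simp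
    qed
    \<comment> \<open>\<open>z\<close> lies between \<open>X c'\<close> and \<open>X c\<close>,
      where \<open>Vx\<close> is increasing. So \<open>1 - Vx\<close> is bounded below left of
      \<open>X c\<close> and above right of it, each time on the side that the sign of
      \<open>X c - X c'\<close> requires.\<close>
    have "- (\<eta> * \<bar>Vx (A c') c' (X c) - 1\<bar>) \<le> (X c - X c') * (1 - Vx (A c') c' z)"
    proof (cases "X c' \<le> X c")
      case True
      have "Vx (A c') c' z \<le> Vx (A c') c' (X c)"
        using incr[of z "X c" c'] z(1,2) True elim \<eta> c' by (cases "z = X c") (auto simp: min_def max_def)
      then have "- \<bar>Vx (A c') c' (X c) - 1\<bar> \<le> 1 - Vx (A c') c' z" by simp
      then have "(X c - X c') * - \<bar>Vx (A c') c' (X c) - 1\<bar> \<le> (X c - X c') * (1 - Vx (A c') c' z)"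
        using True by (intro mult_left_mono) auto
      moreover have "(X c - X c') * \<bar>Vx (A c') c' (X c) - 1\<bar> \<le> \<eta> * \<bar>Vx (A c') c' (X c) - 1\<bar>"
        using elim(2) by (intro mult_right_mono) auto
      ultimately show ?thesis by simp
    next
      case False
      have "Vx (A c') c' (X c) \<le> Vx (A c') c' z"
        using incr[of "X c" z c'] z(1,2) False elim \<eta> c' X' by (cases "z = X c") (auto simp: min_def max_def)
      then have "1 - Vx (A c') c' z \<le> \<bar>Vx (A c') c' (X c) - 1\<bar>" by simp
      then have "(X c' - X c) * (1 - Vx (A c') c' z) \<le> (X c' - X c) * \<bar>Vx (A c') c' (X c) - 1\<bar>"
        using False by (intro mult_left_mono) auto
      also have "\<dots> \<le> \<eta> * \<bar>Vx (A c') c' (X c) - 1\<bar>"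
        using X' by (intro mult_right_mono) auto
      finally show ?thesis by (simp add: algebra_simps)
    qed
    then have "psi c' z * - (\<eta> * \<bar>Vx (A c') c' (X c) - 1\<bar>) \<le> psi c' z * ((X c - X c') * (1 - Vx (A c') c' z))"
      using psi(1) by (rule mult_left_mono)
    moreover have "psi c' z * (\<eta> * \<bar>Vx (A c') c' (X c) - 1\<bar>) \<le> C * \<bar>Vx (A c') c' (X c) - 1\<bar>"
      using psi(2) \<eta>(1) unfolding C_def mult.assoc by (intro mult_right_mono) auto
    ultimately show ?case using z(3) Jf_boundary[OF c'] by (simp add: algebra_simps)
  qed
  have "\<forall>\<^sub>F c' in ?F. - (C * \<bar>(Vx (A c') c' (X c) - Vx (A c) c (X c)) / (c' - c)\<bar>)
      \<le> (Jf (A c') c' (X c) - Jf (A c) c (X c)) / (c' - c)"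
  proof -
    have "\<forall>\<^sub>F c' in ?F. c' \<in> {c<..cb}" by (simp add: eventually_at_filter)
    moreover have "\<forall>\<^sub>F c' in ?F. - (C * \<bar>Vx (A c') c' (X c) - 1\<bar>) \<le> Jf (A c') c' (X c)"
      by (rule filter_leD[OF at_le[OF sub] main])
    ultimately show ?thesis
    proof eventually_elim
      case (elim c')
      then have "- (C * \<bar>Vx (A c') c' (X c) - 1\<bar>) / (c' - c) \<le> Jf (A c') c' (X c) / (c' - c)"
        by (intro divide_right_mono) auto
      then show ?case using elim(1) by (simp add: eq Jf_boundary[OF c] abs_divide)
    qed
  qed
  moreover have "((\<lambda>c'. (Jf (A c') c' (X c) - Jf (A c) c (X c)) / (c' - c)) \<longlongrightarrow> Jc (A c) (A1 c) c (X c)) ?F"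
    using has_field_derivative_subset[OF Jf_c[OF A_derivative[OF c]] sub]
    by (simp add: has_field_derivative_iff)
  moreover have "((\<lambda>c'. - (C * \<bar>(Vx (A c') c' (X c) - Vx (A c) c (X c)) / (c' - c)\<bar>)) \<longlongrightarrow> - (C * \<bar>0\<bar>)) ?F"
  proof (intro tendsto_intros)
    \<comment> \<open>Smooth fit: the \<open>c\<close>-derivative of \<open>Vx\<close> at the fixed
      point \<open>X c\<close> is 0, so the error term is of smaller order than
      \<open>c' - c\<close>.\<close>
    have "Ux (A c) (A1 c) c (X c) = 0"
      using explicit_boundary(3)[OF c, of "X c"] ux_boundary[OF c] boundary_gt[OF c] e0_pos by simp
    then show "((\<lambda>c'. (Vx (A c') c' (X c) - Vx (A c) c (X c)) / (c' - c)) \<longlongrightarrow> 0) ?F"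
      using has_field_derivative_subset[OF Vx_c[OF A_derivative[OF c]] sub, of "X c"]
      by (simp add: has_field_derivative_iff)
  qed
  ultimately have "- (C * \<bar>0\<bar>) \<le> Jc (A c) (A1 c) c (X c)"
    by (intro tendsto_le[OF F])
  with Jc_boundary_neg[OF c] show False by simp
qed

end

subsection \<open>Differentiability and smoothness of the free boundary\<close>

lemma within_interval_bounds:
  fixes f f' :: "real \<Rightarrow> real"
  assumes f: "\<And>x. x \<in> {a..b} \<Longrightarrow> (f has_real_derivative f' x) (at x within {a..b})"
    and bd: "\<And>x. x \<in> {a..b} \<Longrightarrow> K1 \<le> f' x \<and> f' x \<le> K2" and xy: "x \<in> {a..b}" "y \<in> {a..b}" "x \<le> y"
  shows "K1 * (y - x) \<le> f y - f x \<and> f y - f x \<le> K2 * (y - x)"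
proof -
  have "\<exists>t\<in>{x..y}. f y - f x = (\<lambda>h. f' t * h) (y - x)"
  proof (rule mvt_very_simple[OF xy(3)])
    fix t assume t: "x \<le> t" "t \<le> y"
    then show "(f has_derivative (\<lambda>h. f' t * h)) (at t within {x..y})"
      using has_field_derivative_subset[OF f, of t "{x..y}"] xy by (auto simp: has_field_derivative_def)
  qed
  then obtain t where t: "t \<in> {x..y}" "f y - f x = f' t * (y - x)" by auto
  then show ?thesis using bd[of t] xy by (auto intro!: mult_right_mono)
qed

context ratcheting
begin

text \<open>For the upper bound: \<open>Jf\<close> is positive just right of \<open>X c\<close> and,
  at a fixed point there, remains so for nearby \<open>c'\<close>, whereas it is never positive up
  to \<open>X c'\<close>.\<close>

lemma boundary_continuous:
  assumes c: "c \<in> {0..cb}"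
  shows "(X \<longlongrightarrow> X c) (at c within {0..cb})"
proof (rule order_tendstoI)
  show "\<And>a. a < X c \<Longrightarrow> \<forall>\<^sub>F c' in at c within {0..cb}. a < X c'"
    by (rule boundary_lower_semicontinuous[OF c])
next
  fix a assume a: "X c < a"
  have "0 < psi c (X c) * (1 - Vx (A c) c (X c))"
    using Vx_boundary_lt_1[OF c] boundary_gt[OF c] e0_pos psi_pos[of "X c" c] by simp
  then obtain d where d: "0 < d" "\<And>h. 0 < h \<Longrightarrow> h < d \<Longrightarrow> 0 < Jf (A c) c (X c + h)"
    using DERIV_pos_inc_right[OF Jf_x, of c "X c" "A c"] Jf_boundary[OF c] by auto
  define h where "h = min (d / 2) (a - X c)"
  have h: "0 < h" "h < d" "X c + h \<le> a" using d(1) a unfolding h_def by (auto simp: min_def)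
  show "\<forall>\<^sub>F c' in at c within {0..cb}. X c' < a"
    using eventually_Jf_pos[OF c d(2)[OF h(1,2)]] eventually_in_interval
  proof eventually_elim
    case (elim c')
    show ?case
    proof (rule ccontr)
      assume "\<not> X c' < a"
      then have "Jf (A c') c' (X c + h) \<le> 0"
        using h boundary_gt[OF c] e0_pos by (intro Jf_nonpos[OF elim(2)]) auto
      with elim(1) show False by simp
    qed
  qed
qed

definition X1 :: "real \<Rightarrow> real" where
  "X1 c = - Jc (A c) (A1 c) c (X c) / (psi c (X c) * (1 - Vx (A c) c (X c)))"

lemma boundary_denominator_pos: "c \<in> {0..cb} \<Longrightarrow> 0 < psi c (X c) * (1 - Vx (A c) c (X c))"
  using Vx_boundary_lt_1 boundary_gt e0_pos psi_pos[of "X c" c] by (simp add: order_less_trans)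

lemma X1_pos: "c \<in> {0..cb} \<Longrightarrow> 0 < X1 c"
  unfolding X1_def using boundary_denominator_pos Jc_boundary_neg by (intro divide_pos_pos) auto

text \<open>Implicit differentiation along \<open>Jf (A c') c' (X c') = 0\<close>: the mean value
  theorem in \<open>x\<close> expresses the increment of \<open>X\<close> through that of
  \<open>Jf\<close> at the fixed point \<open>X c\<close>, divided by the
  \<open>x\<close>-derivative at a point squeezed to \<open>X c\<close>.\<close>

lemma boundary_derivative:
  assumes c: "c \<in> {0..cb}"
  shows "(X has_real_derivative X1 c) (at c within {0..cb})"
proof -
  let ?F = "at c within {0..cb}"
  let ?P = "\<lambda>x c. psi c x * (1 - Vx (A c) c x)"
  have "\<exists>z. \<bar>z - X c\<bar> \<le> \<bar>X c' - X c\<bar> \<and> Jf (A c') c' (X c') - Jf (A c') c' (X c) = (X c' - X c) * ?P z c'" for c'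
  proof -
    obtain z where "min (X c) (X c') \<le> z" "z \<le> max (X c) (X c')"
        "Jf (A c') c' (X c') - Jf (A c') c' (X c) = (X c' - X c) * ?P z c'"
      using Jf_mvt[of "X c" "X c'" "A c'" c'] by metis
    then show ?thesis by (intro exI[of _ z]) linarith
  qed
  then obtain z where z: "\<And>c'. \<bar>z c' - X c\<bar> \<le> \<bar>X c' - X c\<bar>"
    "\<And>c'. Jf (A c') c' (X c') - Jf (A c') c' (X c) = (X c' - X c) * ?P (z c') c'" by metis
  have "((\<lambda>c'. \<bar>X c' - X c\<bar>) \<longlongrightarrow> 0) ?F"
    using boundary_continuous[OF c] by (simp add: tendsto_rabs_zero_iff LIM_zero_iff)
  then have "((\<lambda>c'. z c' - X c) \<longlongrightarrow> 0) ?F"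
    by (rule Lim_null_comparison[rotated]) (use z in auto)
  then have "(z \<longlongrightarrow> X c) ?F" by (simp add: LIM_zero_iff)
  then have lim: "((\<lambda>c'. (z c', c')) \<longlongrightarrow> (X c, c)) ?F" by (intro tendsto_Pair tendsto_ident_at)
  have P: "((\<lambda>c'. ?P (z c') c') \<longlongrightarrow> ?P (X c) c) ?F"
  proof -
    have "\<forall>\<^sub>F c' in ?F. (z c', c') \<in> UNIV \<times> {0..cb}"
      using eventually_in_interval by (rule eventually_mono) auto
    from continuous_on_tendsto_compose[OF joint_continuous(3) lim _ this] show ?thesis using c by simp
  qed
  note pos = boundary_denominator_pos[OF c]
  have "((\<lambda>c'. - ((Jf (A c') c' (X c) - Jf (A c) c (X c)) / (c' - c)) / ?P (z c') c')
      \<longlongrightarrow> - Jc (A c) (A1 c) c (X c) / ?P (X c) c) ?F"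
    using Jf_c[OF A_derivative[OF c], of "X c"] P pos
    by (intro tendsto_divide tendsto_minus) (auto simp: has_field_derivative_iff)
  moreover have "\<forall>\<^sub>F c' in ?F. - ((Jf (A c') c' (X c) - Jf (A c) c (X c)) / (c' - c)) / ?P (z c') c'
      = (X c' - X c) / (c' - c)"
    using order_tendstoD(1)[OF P pos] eventually_in_interval[of c]
  proof eventually_elim
    case (elim c')
    have "Jf (A c') c' (X c) = - ((X c' - X c) * ?P (z c') c')"
      using z(2)[of c'] Jf_boundary[OF elim(2)] by simp
    then have eq: "- ((Jf (A c') c' (X c) - Jf (A c) c (X c)) / (c' - c)) / ?P (z c') c'
        = (X c' - X c) * ?P (z c') c' / (c' - c) / ?P (z c') c'"
      by (simp only: Jf_boundary[OF c] diff_zero minus_divide_left minus_minus)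
    have "p \<noteq> 0 \<Longrightarrow> a * p / b / p = a / b" for a b p :: real by (simp add: field_simps)
    from this[OF less_imp_neq[OF elim(1), symmetric]] show ?case unfolding eq .
  qed
  ultimately show ?thesis
    unfolding has_field_derivative_iff X1_def by (rule Lim_transform_eventually)
qed

text \<open>\<open>A\<close> is included because the derivative of \<open>X\<close> contains it.
  \<open>kap\<close> is not, since \<open>kap_eq'\<close> makes it rational in \<open>th\<close> and
  \<open>la\<close> and avoids the square root.\<close>

definition generators :: "(real \<Rightarrow> real) set" where
  "generators = {X, A, th, la, \<lambda>c. c}"

lemma generators_algebra:
  "(\<lambda>c. X c) \<in> smooth_algebra {0..cb} generators" "(\<lambda>c. A c) \<in> smooth_algebra {0..cb} generators"
  "(\<lambda>c. th c) \<in> smooth_algebra {0..cb} generators" "(\<lambda>c. la c) \<in> smooth_algebra {0..cb} generators"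
  "(\<lambda>c. c) \<in> smooth_algebra {0..cb} generators"
  by (auto intro: smooth_algebra.base simp: generators_def)

lemmas smooth_algebra_intros = generators_algebra smooth_algebra.const smooth_algebra.add smooth_algebra_diff
  smooth_algebra_uminus smooth_algebra.mult smooth_algebra_divide smooth_algebra.exp

lemma kap_algebra: "(\<lambda>c. kap c) \<in> smooth_algebra {0..cb} generators"
  unfolding kap_eq' using th_pos la_pos \<sigma>_pos
  by (intro smooth_algebra_intros) (auto simp: add_pos_pos less_imp_neq[symmetric])

text \<open>The definition of \<open>A1\<close> involves \<open>u\<close>; since \<open>u\<close> vanishes at the boundary, \<open>A1\<close> can be rewritten in
  terms of the generators.\<close>

definition A1' :: "real \<Rightarrow> real" where "A1' c = Uf (A c) 0 c (X c) / hom c (X c)"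

lemma A1_eq: 
  assumes c: "c \<in> {0..cb}"
  shows "A1 c = A1' c"
proof -
  have X: "0 < X c" using boundary_gt[OF c] e0_pos by simp
  then have "Uf (A c) (A1 c) c (X c) = 0"
    using explicit_boundary(2)[OF c, of "X c"] u_boundary[OF c] by simp
  then show ?thesis using hom_pos[OF X, of c] by (subst (asm) Uf_add) (simp add: A1'_def)
qed

lemma A1'_algebra: "(\<lambda>c. A1' c) \<in> smooth_algebra {0..cb} generators"
proof -
  have "hom c (X c) \<noteq> 0" if "c \<in> {0..cb}" for c
    using hom_pos[of "X c" c] boundary_gt[OF that] e0_pos by simp
  then show ?thesis
    unfolding A1'_def Uf_def hom_def using r_pos
    by (intro smooth_algebra_intros kap_algebra) auto
qed

definition X1' :: "real \<Rightarrow> real" where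
  "X1' c = - Jc (A c) (A1' c) c (X c) / (psi c (X c) * (1 - Vx (A c) c (X c)))"

lemma X1'_algebra: "(\<lambda>c. X1' c) \<in> smooth_algebra {0..cb} generators"
proof -
  have nz: "psi c (X c) * (1 - Vx (A c) c (X c)) \<noteq> 0" if "c \<in> {0..cb}" for c
    using boundary_denominator_pos[OF that] by (metis less_irrefl)
  have s: "th c + la c \<noteq> 0" for c using th_pos[of c] la_pos[of c] by simp
  have "(\<lambda>c. Jc (A c) (A1' c) c (X c)) \<in> smooth_algebra {0..cb} generators"
    unfolding Jc_def power2_eq_square using r_pos th_pos la_pos s
    by (intro smooth_algebra_intros kap_algebra A1'_algebra) (auto simp: less_imp_neq[symmetric])
  moreover have "(\<lambda>c. psi c (X c) * (1 - Vx (A c) c (X c))) \<in> smooth_algebra {0..cb} generators"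
    unfolding psi_def Vx_def using r_pos by (intro smooth_algebra_intros) auto
  ultimately show ?thesis
    unfolding X1'_def by (intro smooth_algebra_divide smooth_algebra_uminus nz)
qed

lemma generators_derivative:
  assumes "f \<in> generators"
  shows "\<exists>g\<in>smooth_algebra {0..cb} generators. \<forall>c\<in>{0..cb}. (f has_real_derivative g c) (at c within {0..cb})"
proof -
  consider "f = X" | "f = A" | "f = th" | "f = la" | "f = (\<lambda>c. c)" using assms by (auto simp: generators_def)
  then show ?thesis
  proof cases
    case 1
    have "X1 c = X1' c" if "c \<in> {0..cb}" for c using A1_eq[OF that] by (simp add: X1_def X1'_def)
    then show ?thesis using 1 boundary_derivative by (intro bexI[OF _ X1'_algebra]) auto
  next
    case 2
    then show ?thesis using A_derivative A1_eq by (intro bexI[OF _ A1'_algebra]) auto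
  next
    case 3
    then show ?thesis using th_derivative
      by (intro bexI[of _ "\<lambda>c. kap c * th c"] smooth_algebra_intros kap_algebra) auto
  next
    case 4
    then show ?thesis using la_derivative
      by (intro bexI[of _ "\<lambda>c. - (kap c * la c)"] smooth_algebra_intros kap_algebra) auto
  next
    case 5
    then show ?thesis by (intro bexI[of _ "\<lambda>_. 1"] smooth_algebra_intros) auto
  qed
qed

lemma boundary_smooth: "C_infinity_on {0..cb} X"
  by (rule smooth_algebra_C_infinity_on[OF generators_derivative generators_algebra(1)])

lemma X1_continuous: "continuous_on {0..cb} X1"
proof -
  obtain g where "\<forall>c\<in>{0..cb}. (X1' has_real_derivative g c) (at c within {0..cb})"
    using smooth_algebra_derivative[OF generators_derivative X1'_algebra] by auto
  then have "continuous_on {0..cb} X1'" by (intro DERIV_continuous_on) auto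
  then show ?thesis
    by (rule continuous_on_cong[THEN iffD1, rotated 2]) (auto simp: X1_def X1'_def A1_eq)
qed

lemma X1_bounds:
  obtains K1 K2 where "0 < K1" "K1 < K2" "\<And>c. c \<in> {0..cb} \<Longrightarrow> K1 \<le> X1 c \<and> X1 c \<le> K2"
proof -
  have ne: "{0..cb} \<noteq> {}" using cb_nonneg by simp
  obtain a where a: "a \<in> {0..cb}" "\<And>c. c \<in> {0..cb} \<Longrightarrow> X1 a \<le> X1 c"
    using continuous_attains_inf[OF compact_Icc ne X1_continuous] by auto
  obtain b where b: "b \<in> {0..cb}" "\<And>c. c \<in> {0..cb} \<Longrightarrow> X1 c \<le> X1 b"
    using continuous_attains_sup[OF compact_Icc ne X1_continuous] by auto
  show thesis
  proof (rule that)
    show "0 < X1 a" by (rule X1_pos[OF a(1)])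
    \<comment> \<open>The \<open>+ 1\<close> keeps the two constants distinct even if
      \<open>X1\<close> is constant.\<close>
    show "X1 a < X1 b + 1" using a(2)[OF b(1)] by simp
    show "X1 a \<le> X1 c \<and> X1 c \<le> X1 b + 1" if "c \<in> {0..cb}" for c
      using a(2)[OF that] b(2)[OF that] by simp
  qed
qed

end

section \<open>Derivative bounds turned into a two-sided Lipschitz estimate\<close>

theorem theorem3p4:
  fixes \<mu> \<sigma> r cb :: real and v u :: "real \<Rightarrow> real \<Rightarrow> real" and X :: "real \<Rightarrow> real"
  assumes "\<mu> > 0" and "\<sigma> > 0" and "r > 0" and "0 \<le> cb" and "cb \<le> \<mu>"
    and "2 * \<mu> * cb > \<sigma>\<^sup>2 * r"
    and "solution_pair \<mu> \<sigma> r cb v u"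
  defines "X \<equiv> free_boundary cb v"
  shows "(\<forall>c\<in>{0..cb}. {x. x > 0 \<and> partial_c cb v x c = 0} \<noteq> {} \<and> X c > 0) \<and>
    (\<forall>x\<ge>0. \<forall>c\<in>{0..cb}.
       (X c \<le> x \<longrightarrow> partial_c cb v x c = 0) \<and>
       (0 < x \<and> x < X c \<longrightarrow> partial_c cb v x c < 0)) \<and>
    C_infinity_on {0..cb} X \<and>
    (\<exists>K1 K2. 0 < K1 \<and> K1 < K2 \<and>
       (\<forall>c\<in>{0..cb}. K1 \<le> vector_derivative X (at c within {0..cb}) \<and>
                     vector_derivative X (at c within {0..cb}) \<le> K2)) \<and>
    strict_mono_on {0..cb} X \<and>
    (\<exists>L. L-lipschitz_on {0..cb} X) \<and>
    strict_mono_on (X ` {0..cb}) (inv_into {0..cb} X) \<and>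
    (\<exists>L. L-lipschitz_on (X ` {0..cb}) (inv_into {0..cb} X))"
proof -
  interpret ratcheting \<mu> \<sigma> r cb v u
    using assms(1-7) by unfold_locales auto
  obtain K1 K2 where K: "0 < K1" "K1 < K2" "\<And>c. c \<in> {0..cb} \<Longrightarrow> K1 \<le> X1 c \<and> X1 c \<le> K2"
    by (rule X1_bounds) blast
  have deriv: "(X has_real_derivative X1 c) (at c within {0..cb})" if "c \<in> {0..cb}" for c
    unfolding X_def by (rule boundary_derivative[OF that])
  have bounds: "K1 * (c' - c) \<le> X c' - X c \<and> X c' - X c \<le> K2 * (c' - c)"
    if "c \<in> {0..cb}" "c' \<in> {0..cb}" "c \<le> c'" for c c'
    by (rule within_interval_bounds[of 0 cb X X1]) (use deriv K(3) that in auto)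
  have vd: "vector_derivative X (at c within {0..cb}) = X1 c" if "c \<in> {0..cb}" for c
    using vector_derivative_within_closed_interval[OF cb_pos that] deriv[OF that]
    by (simp add: has_real_derivative_iff_has_vector_derivative)
  have mono: "X c < X c'" if "c \<in> {0..cb}" "c' \<in> {0..cb}" "c < c'" for c c'
    using bounds[of c c'] that mult_pos_pos[OF K(1), of "c' - c"] by simp
  \<comment> \<open>The upper half gives the Lipschitz constant \<open>K2\<close> of
    \<open>X\<close>, the lower half the constant \<open>1 / K1\<close> of its inverse.\<close>
  have dist: "K1 * \<bar>c' - c\<bar> \<le> \<bar>X c' - X c\<bar> \<and> \<bar>X c' - X c\<bar> \<le> K2 * \<bar>c' - c\<bar>"
    if "c \<in> {0..cb}" "c' \<in> {0..cb}" for c c'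
  proof (cases "c \<le> c'")
    case True
    then have "X c \<le> X c'" using mono[OF that] by (cases "c = c'") auto
    then show ?thesis using bounds[OF that True] True by simp
  next
    case False
    then have "X c' \<le> X c" using mono[OF that(2,1)] by simp
    then show ?thesis using bounds[OF that(2,1)] False by (simp add: abs_minus_commute)
  qed
  have sm: "strict_mono_on {0..cb} X" using mono by (intro strict_mono_onI) auto
  then have inj: "inj_on X {0..cb}" by (rule strict_mono_on_imp_inj_on)
  have smi: "strict_mono_on (X ` {0..cb}) (inv_into {0..cb} X)"
  proof (rule strict_mono_onI)
    fix x y assume "x \<in> X ` {0..cb}" "y \<in> X ` {0..cb}" "x < y"
    then obtain c c' where c: "c \<in> {0..cb}" "c' \<in> {0..cb}" "x = X c" "y = X c'" by blast
    with \<open>x < y\<close> have "c < c'" using mono[of c' c] by (metis less_asym linorder_neqE_linordered_idom)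
    with c show "inv_into {0..cb} X x < inv_into {0..cb} X y" by (simp add: inv_into_f_f[OF inj])
  qed
  have lip: "K2-lipschitz_on {0..cb} X"
    using dist K by (intro lipschitz_onI) (auto simp: dist_real_def)
  have lipi: "(1 / K1)-lipschitz_on (X ` {0..cb}) (inv_into {0..cb} X)"
  proof (rule lipschitz_onI)
    fix x y assume "x \<in> X ` {0..cb}" "y \<in> X ` {0..cb}"
    then obtain c c' where c: "c \<in> {0..cb}" "c' \<in> {0..cb}" "x = X c" "y = X c'" by blast
    then show "dist (inv_into {0..cb} X x) (inv_into {0..cb} X y) \<le> 1 / K1 * dist x y"
      using dist[OF c(2,1)] K(1) by (simp add: inv_into_f_f[OF inj] dist_real_def field_simps)
  qed (use K in simp)
  \<comment> \<open>\<open>X c\<close> itself belongs to the set, so its infimum is a genuine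
    one.\<close>
  have pos: "0 < X c" "X c \<in> {x. x > 0 \<and> partial_c cb v x c = 0}" if c: "c \<in> {0..cb}" for c
    using boundary_gt[OF c] e0_pos u_boundary[OF c] partial_c_v[of "X c" c] c by (auto simp: X_def)
  have sign: "(X c \<le> x \<longrightarrow> partial_c cb v x c = 0) \<and> (0 < x \<and> x < X c \<longrightarrow> partial_c cb v x c < 0)"
    if "0 \<le> x" "c \<in> {0..cb}" for x c
    using partial_c_v[OF that] u_zero_above[OF that(2)] u_pos_below[OF that(2)] by (simp add: X_def)
  show ?thesis
  proof (intro conjI)
    show "\<forall>c\<in>{0..cb}. {x. x > 0 \<and> partial_c cb v x c = 0} \<noteq> {} \<and> X c > 0"
      using pos by (metis empty_iff)
    show "\<exists>K1 K2. 0 < K1 \<and> K1 < K2 \<and>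
       (\<forall>c\<in>{0..cb}. K1 \<le> vector_derivative X (at c within {0..cb}) \<and>
                     vector_derivative X (at c within {0..cb}) \<le> K2)"
      using K vd by (intro exI[of _ K1] exI[of _ K2]) simp
    show "C_infinity_on {0..cb} X" using boundary_smooth by (simp add: X_def)
  qed (use sign sm smi lip lipi in auto)
qed

end
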